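(* Let $d,n\ge 1$, let $\varphi:\mathcal T_d\to M_n$ be a completely positive map, and let $P_\varphi$ be its polynomial density. Then $\varphi$ has a unique completely positive extension $\tilde\varphi:M_d\to M_n$ if and only if for every pair of Fejér--Riesz factors $F,H$ of $P_\varphi$, that is, $$P_\varphi(z)=F(z)^*F(z)=H(z)^*H(z)\quad(z\in\mathbb T),\qquad F(z)=\sum_{j=0}^{d-1}F_jz^j,\quad H(z)=\sum_{j=0}^{d-1}H_jz^j,$$ one has $$[F_i^*F_j]_{i,j=0}^{d-1}=[H_i^*H_j]_{i,j=0}^{d-1}.$$
   Context: $\mathbb T$ is the unit circle, $M_n=M_n(\mathbb C)$. $\mathcal T_d\subseteq M_d$ is the operator system of all $d\times d$ Toeplitz matrices $[a_{i-j}]_{i,j=0}^{d-1}$. $J\in M_d$ is the matrix with ones on the first superdiagonal and zeros elsewhere. The polynomial density of a linear map $\varphi:\mathcal T_d\to M_n$ is $$P_\varphi(z)=\varphi(I)+\sum_{k=1}^{d-1}\varphi(J^k)z^k+\sum_{k=1}^{d-1}\varphi((J^* )^k)z^{-k},\qquad z\in\mathbb T.$$ A Fejér--Riesz factor of $P_\varphi$ is a matrix polynomial $F(z)=F_0+F_1z+\cdots+F_{d-1}z^{d-1}$ with $F_j\in M_{m,n}(\mathbb C)$ such that $P_\varphi(z)=F(z)^*F(z)$ for all $z\in\mathbb T$; the number of rows $m$ is allowed to depend on $F$. A completely positive extension of $\varphi$ to $M_d$ is a completely positive map $\tilde\varphi:M_d\to M_n$ with $\tilde\varphi|_{\mathcal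 T_d}=\varphi$. The matrix $[F_i^*F_j]_{i,j=0}^{d-1}\in M_d(M_n)$ is the coefficient Gram matrix $G_F$ of $F$. *)

theory Defs
  imports "HOL-Library.FuncSet" "Jordan_Normal_Form.Schur_Decomposition"
begin

text \<open>Matrices are the carrier-based \<^typ>\<open>complex mat\<close>; \<^term>\<open>carrier_mat m n\<close> is
  \<open>M\<^bsub>m,n\<^esub>(\<complex>)\<close>. The order on \<^typ>\<open>complex\<close> is that of \<open>Complex_Order\<close>:
  \<open>0 \<le> z\<close> says that \<open>z\<close> is real and nonnegative.
  A map on a set of matrices is a HOL function whose values off that set carry no information.\<close>

definition psd_mat :: "nat \<Rightarrow> complex mat \<Rightarrow> bool" where
  "psd_mat n A \<longleftrightarrow> A \<in> carrier_mat n n \<and> (\<forall>v\<in>carrier_vec n. 0 \<le> (A *\<^sub>v v) \<bullet>c v)"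

text \<open>The element \<open>[X i j]\<close> of \<open>M\<^sub>k(M\<^sub>d)\<close>, identified with \<open>M\<^bsub>kd\<^esub>\<close>.\<close>

definition block_mat :: "nat \<Rightarrow> nat \<Rightarrow> (nat \<Rightarrow> nat \<Rightarrow> complex mat) \<Rightarrow> complex mat" where
  "block_mat k d X = mat (k * d) (k * d) (\<lambda>(r, c). X (r div d) (c div d) $$ (r mod d, c mod d))"

definition mat_sum :: "nat \<Rightarrow> nat \<Rightarrow> ('i \<Rightarrow> complex mat) \<Rightarrow> 'i set \<Rightarrow> complex mat" where
  "mat_sum m n f I = mat m n (\<lambda>(r, c). \<Sum>i\<in>I. f i $$ (r, c))"

definition toeplitz :: "nat \<Rightarrow> complex mat set" where
  "toeplitz d = {A. \<exists>a :: int \<Rightarrow> complex. A = mat d d (\<lambda>(i, j). a (int i - int j))}"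

definition shift_mat :: "nat \<Rightarrow> complex mat" where
  "shift_mat d = mat d d (\<lambda>(i, j). if j = i + 1 then 1 else 0)"

definition linear_mat_map :: "complex mat set \<Rightarrow> nat \<Rightarrow> (complex mat \<Rightarrow> complex mat) \<Rightarrow> bool" where
  "linear_mat_map S n \<phi> \<longleftrightarrow>
     (\<forall>A\<in>S. \<phi> A \<in> carrier_mat n n) \<and>
     (\<forall>A\<in>S. \<forall>B\<in>S. \<phi> (A + B) = \<phi> A + \<phi> B) \<and>
     (\<forall>c. \<forall>A\<in>S. \<phi> (c \<cdot>\<^sub>m A) = c \<cdot>\<^sub>m \<phi> A)"

text \<open>Completely positive linear maps \<open>S \<rightarrow> M\<^sub>n\<close> on a subspace \<open>S\<close> of \<open>M\<^sub>d\<close>: every ampliation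
  \<open>M\<^sub>k(S) \<rightarrow> M\<^sub>k(M\<^sub>n)\<close> is positive.\<close>

definition cp_map :: "nat \<Rightarrow> complex mat set \<Rightarrow> nat \<Rightarrow> (complex mat \<Rightarrow> complex mat) \<Rightarrow> bool" where
  "cp_map d S n \<phi> \<longleftrightarrow> linear_mat_map S n \<phi> \<and>
     (\<forall>k\<ge>1. \<forall>X. (\<forall>i<k. \<forall>j<k. X i j \<in> S) \<and> psd_mat (k * d) (block_mat k d X)
        \<longrightarrow> psd_mat (k * n) (block_mat k n (\<lambda>i j. \<phi> (X i j))))"

text \<open>The extensionality clause makes two extensions that agree on \<open>M\<^sub>d\<close> equal as HOL functions.\<close>

definition cp_extension ::
  "nat \<Rightarrow> nat \<Rightarrow> (complex mat \<Rightarrow> complex mat) \<Rightarrow> (complex mat \<Rightarrow> complex mat) \<Rightarrow> bool" where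
  "cp_extension d n \<phi> \<psi> \<longleftrightarrow> \<psi> \<in> extensional (carrier_mat d d) \<and>
     cp_map d (carrier_mat d d) n \<psi> \<and> (\<forall>A\<in>toeplitz d. \<psi> A = \<phi> A)"

definition poly_density ::
  "nat \<Rightarrow> nat \<Rightarrow> (complex mat \<Rightarrow> complex mat) \<Rightarrow> complex \<Rightarrow> complex mat" where
  "poly_density d n \<phi> z =
     \<phi> (1\<^sub>m d)
     + mat_sum n n (\<lambda>k. z ^ k \<cdot>\<^sub>m \<phi> (shift_mat d ^\<^sub>m k)) {1..<d}
     + mat_sum n n (\<lambda>k. z powi (- int k) \<cdot>\<^sub>m \<phi> (mat_adjoint (shift_mat d) ^\<^sub>m k)) {1..<d}"

text \<open>A matrix polynomial of degree less than \<open>d\<close> is given by its coefficients \<open>F 0, \<dots>, F (d - 1)\<close>.\<close>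

definition mat_poly_eval ::
  "nat \<Rightarrow> nat \<Rightarrow> nat \<Rightarrow> (nat \<Rightarrow> complex mat) \<Rightarrow> complex \<Rightarrow> complex mat" where
  "mat_poly_eval d m n F z = mat_sum m n (\<lambda>j. z ^ j \<cdot>\<^sub>m F j) {..<d}"

definition fejer_riesz_factor ::
  "nat \<Rightarrow> nat \<Rightarrow> (complex mat \<Rightarrow> complex mat) \<Rightarrow> nat \<Rightarrow> (nat \<Rightarrow> complex mat) \<Rightarrow> bool" where
  "fejer_riesz_factor d n \<phi> m F \<longleftrightarrow>
     (\<forall>j<d. F j \<in> carrier_mat m n) \<and>
     (\<forall>z. cmod z = 1 \<longrightarrow>
        poly_density d n \<phi> z = mat_adjoint (mat_poly_eval d m n F z) * mat_poly_eval d m n F z)"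

definition gram_mat :: "nat \<Rightarrow> nat \<Rightarrow> (nat \<Rightarrow> complex mat) \<Rightarrow> complex mat" where
  "gram_mat d n F = block_mat d n (\<lambda>i j. mat_adjoint (F i) * F j)"

end

theory Submission
  imports Defs "HOL-Analysis.Function_Topology"
begin

text \<open>Completely positive extensions of \<open>\<phi>\<close> correspond through their Choi matrices to the positive
  block matrices whose block diagonal sums are the coefficients of \<open>P\<^sub>\<phi>\<close>, and these are precisely
  the Gram matrices of the Fejer--Riesz factors: a Cholesky factorisation turns a positive
  block matrix into a factor. So uniqueness on both sides is the same statement, and what remains
  is that at least one extension exists. For this take a positive block matrix whose diagonal
  sums are nearest to the coefficients of \<open>P\<^sub>\<phi>\<close> (it exists by compactness). The negated adjoint
  of the residual is a positive block Toeplitz matrix, so \<open>n\<close>-positivity of \<open>\<phi>\<close> makes its pairing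
  with \<open>\<phi>\<close> nonnegative; but this pairing is at most minus the squared norm of the residual,
  which therefore vanishes.\<close>

section \<open>Positive semidefinite kernels on a finite index set\<close>

text \<open>Two points shape the existence argument. A linear image of a closed cone need not be
  closed; here it works because diagonal 0 carries the trace of a positive kernel and the trace
  bounds every entry, so the minimisation takes place on a compact set. Moreover, minimality
  controls only real parts, whereas positivity of the block Toeplitz matrix asks for a real
  quadratic form; therefore the self-adjointness of the coefficients of \<open>\<phi>\<close> is
  established separately, by evaluating \<open>\<phi>\<close> at rank one Toeplitz matrices.
  Positivity is a property of kernels on an arbitrary index set because the same matrix is read with
  indices (position, entry), (entry, position) or a flattened number. Since \<open>0 \<le>\<close>
  on complex numbers includes being real, Hermitian symmetry is a consequence and not a
  clause.\<close>

definition psd_on :: "'a set \<Rightarrow> ('a \<Rightarrow> 'a \<Rightarrow> complex) \<Rightarrow> bool" where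
  "psd_on I K \<longleftrightarrow> (\<forall>v. 0 \<le> (\<Sum>x\<in>I. \<Sum>y\<in>I. K x y * v y * cnj (v x)))"

lemma psd_onD: "psd_on I K \<Longrightarrow> 0 \<le> (\<Sum>x\<in>I. \<Sum>y\<in>I. K x y * v y * cnj (v x))"
  by (simp add: psd_on_def)

lemma psd_on_cong:
  assumes "\<And>x y. x \<in> I \<Longrightarrow> y \<in> I \<Longrightarrow> K x y = K' x y"
  shows "psd_on I K \<longleftrightarrow> psd_on I K'"
  using assms by (simp add: psd_on_def cong: sum.cong)

lemma psd_on_reindex:
  assumes "bij_betw g J I"
  shows "psd_on I K \<longleftrightarrow> psd_on J (\<lambda>x y. K (g x) (g y))"
proof
  assume K: "psd_on I K"
  show "psd_on J (\<lambda>x y. K (g x) (g y))"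
    unfolding psd_on_def
  proof
    fix v
    have inj: "inj_on g J" and im: "I = g ` J"
      using assms by (auto simp: bij_betw_def)
    have "0 \<le> (\<Sum>x\<in>I. \<Sum>y\<in>I. K x y * v (inv_into J g y) * cnj (v (inv_into J g x)))"
      by (rule psd_onD[OF K])
    also have "\<dots> = (\<Sum>x\<in>J. \<Sum>y\<in>J. K (g x) (g y) * v y * cnj (v x))"
      unfolding im using inj by (simp add: sum.reindex inv_into_f_f cong: sum.cong)
    finally show "0 \<le> (\<Sum>x\<in>J. \<Sum>y\<in>J. K (g x) (g y) * v y * cnj (v x))" .
  qed
next
  assume K: "psd_on J (\<lambda>x y. K (g x) (g y))"
  show "psd_on I K"
    unfolding psd_on_def
  proof
    fix v
    have "0 \<le> (\<Sum>x\<in>J. \<Sum>y\<in>J. K (g x) (g y) * v (g y) * cnj (v (g x)))"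
      using psd_onD[OF K, of "\<lambda>x. v (g x)"] .
    also have "\<dots> = (\<Sum>x\<in>I. \<Sum>y\<in>I. K x y * v y * cnj (v x))"
      by (simp add: sum.reindex_bij_betw[OF assms, where g="\<lambda>y. K _ y * v y * _"]
           sum.reindex_bij_betw[OF assms, where g="\<lambda>x. \<Sum>y\<in>I. K x y * v y * cnj (v x)"])
    finally show "0 \<le> (\<Sum>x\<in>I. \<Sum>y\<in>I. K x y * v y * cnj (v x))" .
  qed
qed

lemma psd_on_subset:
  assumes "psd_on I K" "J \<subseteq> I" "finite I"
  shows "psd_on J K"
  unfolding psd_on_def
proof
  fix v :: "'a \<Rightarrow> complex"
  let ?w = "\<lambda>x. if x \<in> J then v x else 0"
  have "0 \<le> (\<Sum>x\<in>I. \<Sum>y\<in>I. K x y * ?w y * cnj (?w x))"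
    by (rule psd_onD[OF assms(1)])
  also have "\<dots> = (\<Sum>x\<in>J. \<Sum>y\<in>I. K x y * ?w y * cnj (?w x))"
    by (rule sum.mono_neutral_right) (use assms in auto)
  also have "\<dots> = (\<Sum>x\<in>J. \<Sum>y\<in>J. K x y * ?w y * cnj (?w x))"
    by (intro sum.cong refl sum.mono_neutral_right) (use assms in auto)
  finally show "0 \<le> (\<Sum>x\<in>J. \<Sum>y\<in>J. K x y * v y * cnj (v x))"
    by (simp cong: sum.cong)
qed

lemma psd_on_zero [simp]: "psd_on I (\<lambda>x y. 0)"
  by (simp add: psd_on_def)

lemma psd_on_add:
  assumes "psd_on I K" "psd_on I L"
  shows "psd_on I (\<lambda>x y. K x y + L x y)"
  unfolding psd_on_def
proof
  fix v
  have "0 \<le> (\<Sum>x\<in>I. \<Sum>y\<in>I. K x y * v y * cnj (v x)) + (\<Sum>x\<in>I. \<Sum>y\<in>I. L x y * v y * cnj (v x))"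
    by (intro add_nonneg_nonneg psd_onD assms)
  then show "0 \<le> (\<Sum>x\<in>I. \<Sum>y\<in>I. (K x y + L x y) * v y * cnj (v x))"
    by (simp add: algebra_simps sum.distrib)
qed

lemma psd_on_sum:
  assumes "\<And>r. r \<in> S \<Longrightarrow> psd_on I (K r)"
  shows "psd_on I (\<lambda>x y. \<Sum>r\<in>S. K r x y)"
  using assms
  by (induction S rule: infinite_finite_induct) (auto intro: psd_on_add)

lemma psd_on_scale:
  assumes "psd_on I K" "0 \<le> t"
  shows "psd_on I (\<lambda>x y. complex_of_real t * K x y)"
  unfolding psd_on_def
proof
  fix v
  have "0 \<le> complex_of_real t * (\<Sum>x\<in>I. \<Sum>y\<in>I. K x y * v y * cnj (v x))"
    using psd_onD[OF assms(1), of v] assms(2) by (simp add: less_eq_complex_def)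
  then show "0 \<le> (\<Sum>x\<in>I. \<Sum>y\<in>I. complex_of_real t * K x y * v y * cnj (v x))"
    by (simp add: sum_distrib_left mult.assoc)
qed

text \<open>The form of the congruent kernel at \<open>v\<close> is the form of \<open>K\<close> at
  the vector \<open>W v\<close>, called \<open>s\<close> below. This yields rank one kernels and,
  later, complete positivity of \<open>gram_map\<close>.\<close>

lemma psd_on_congruence:
  assumes "psd_on J K"
  shows "psd_on I (\<lambda>x y. \<Sum>u\<in>J. \<Sum>w\<in>J. cnj (W u x) * K u w * W w y)"
  unfolding psd_on_def
proof
  fix v
  define s where "s u = (\<Sum>y\<in>I. W u y * v y)" for u
  have s2: "K u w * s w * cnj (s u) = (\<Sum>x\<in>I. \<Sum>y\<in>I. cnj (W u x) * K u w * W w y * v y * cnj (v x))" for u w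
  proof -
    have "K u w * s w * cnj (s u) = K u w * (cnj (s u) * s w)"
      by (simp add: mult_ac)
    also have "\<dots> = K u w * (\<Sum>x\<in>I. \<Sum>y\<in>I. cnj (W u x * v x) * (W w y * v y))"
      by (simp only: s_def sum_product cnj_sum)
    finally show ?thesis
      by (simp add: sum_distrib_left mult_ac)
  qed
  have "0 \<le> (\<Sum>u\<in>J. \<Sum>w\<in>J. K u w * s w * cnj (s u))"
    by (rule psd_onD[OF assms])
  also have "\<dots> = (\<Sum>u\<in>J. \<Sum>w\<in>J. \<Sum>x\<in>I. \<Sum>y\<in>I. cnj (W u x) * K u w * W w y * v y * cnj (v x))"
    by (simp only: s2)
  also have "\<dots> = (\<Sum>u\<in>J. \<Sum>x\<in>I. \<Sum>w\<in>J. \<Sum>y\<in>I. cnj (W u x) * K u w * W w y * v y * cnj (v x))"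
    by (intro sum.cong refl sum.swap)
  also have "\<dots> = (\<Sum>x\<in>I. \<Sum>u\<in>J. \<Sum>w\<in>J. \<Sum>y\<in>I. cnj (W u x) * K u w * W w y * v y * cnj (v x))"
    by (rule sum.swap)
  also have "\<dots> = (\<Sum>x\<in>I. \<Sum>u\<in>J. \<Sum>y\<in>I. \<Sum>w\<in>J. cnj (W u x) * K u w * W w y * v y * cnj (v x))"
    by (intro sum.cong refl sum.swap)
  also have "\<dots> = (\<Sum>x\<in>I. \<Sum>y\<in>I. \<Sum>u\<in>J. \<Sum>w\<in>J. cnj (W u x) * K u w * W w y * v y * cnj (v x))"
    by (intro sum.cong refl sum.swap)
  finally show "0 \<le> (\<Sum>x\<in>I. \<Sum>y\<in>I. (\<Sum>u\<in>J. \<Sum>w\<in>J. cnj (W u x) * K u w * W w y) * v y * cnj (v x))"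
    by (simp add: sum_distrib_right)
qed

lemma psd_on_rank_one: "psd_on I (\<lambda>x y. cnj (u x) * u y)"
proof -
  have "psd_on {()} (\<lambda>x y. 1)"
    by (simp add: psd_on_def less_eq_complex_def)
  from psd_on_congruence[OF this, of I "\<lambda>_. u"] show ?thesis by simp
qed

lemma psd_on_two_points:
  assumes "psd_on I K" "finite I" "x \<in> I" "y \<in> I" "x \<noteq> y"
  shows "0 \<le> K x x * \<alpha> * cnj \<alpha> + K x y * \<beta> * cnj \<alpha> + K y x * \<alpha> * cnj \<beta> + K y y * \<beta> * cnj \<beta>"
proof -
  have "psd_on {x, y} K"
    by (rule psd_on_subset) (use assms in auto)
  from psd_onD[OF this, of "\<lambda>z. if z = x then \<alpha> else \<beta>"] show ?thesis
    using assms(5) by (simp add: algebra_simps)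
qed

lemma psd_on_diag:
  assumes "psd_on I K" "finite I" "x \<in> I"
  shows "0 \<le> K x x"
proof -
  have "psd_on {x} K"
    by (rule psd_on_subset) (use assms in auto)
  from psd_onD[OF this, of "\<lambda>z. 1"] show ?thesis
    by simp
qed

lemma psd_on_hermitian:
  assumes "psd_on I K" "finite I" "x \<in> I" "y \<in> I"
  shows "K y x = cnj (K x y)"
proof (cases "x = y")
  case True
  then show ?thesis
    using psd_on_diag[OF assms(1,2,3)] by (simp add: less_eq_complex_def complex_eq_iff)
next
  case False
  \<comment> \<open>The forms at (1, 1) and (1, \<i>) must be real: the first makes the imaginary
    parts of \<open>K x y\<close> and \<open>K y x\<close> opposite, the second makes their real
    parts equal.\<close>
  show ?thesis
    using psd_on_two_points[OF assms False, of 1 1] psd_on_two_points[OF assms False, of 1 \<i>]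
      psd_on_diag[OF assms(1,2,3)] psd_on_diag[OF assms(1,2,4)]
    by (auto simp: less_eq_complex_def complex_eq_iff)
qed

text \<open>A large second coordinate in the direction of \<open>- cnj (K x y)\<close> costs nothing
  on the diagonal, while the cross terms lower the form linearly without bound unless
  \<open>K x y\<close> vanishes.\<close>

lemma psd_on_diag_zero:
  assumes "psd_on I K" "finite I" "x \<in> I" "y \<in> I" "K y y = 0"
  shows "K x y = 0"
proof (cases "x = y")
  case False
  define s where "s = (cmod (K x y))\<^sup>2"
  have h: "K y x = cnj (K x y)"
    by (rule psd_on_hermitian) fact+
  have eq: "K x y * cnj (K x y) = complex_of_real s"
    unfolding s_def by (metis complex_norm_square)
  have *: "0 \<le> Re (K x x) - 2 * r * s" for r :: real
  proof -
    have "0 \<le> K x x + K x y * (- of_real r * cnj (K x y)) + cnj (K x y) * cnj (- of_real r * cnj (K x y))"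
      using psd_on_two_points[OF assms(1-4) False, of 1 "- of_real r * cnj (K x y)"] assms(5) h by simp
    also have "\<dots> = K x x - 2 * of_real r * (K x y * cnj (K x y))"
      by (simp add: algebra_simps)
    finally show ?thesis
      unfolding eq by (simp add: less_eq_complex_def)
  qed
  have "s = 0"
  proof (rule ccontr)
    assume "s \<noteq> 0"
    \<comment> \<open>This value of \<open>r\<close> makes the right-hand side of the inequality
      equal to -1.\<close>
    then show False
      using *[of "(Re (K x x) + 1) / (2 * s)"] by simp
  qed
  then show ?thesis
    by (simp add: s_def)
qed (use assms in simp)

text \<open>Elimination of one index at a time: subtracting the rank one kernel of the row at
  \<open>z\<close> leaves the Schur complement, which is again positive. The factor has one row per
  element of \<open>I\<close>, the origin of the row count \<open>d * n\<close> later on.\<close>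

lemma psd_on_cholesky:
  assumes "finite I" "psd_on I K"
  obtains F :: "'a \<Rightarrow> 'a \<Rightarrow> complex"
  where "\<And>x y. x \<in> I \<Longrightarrow> y \<in> I \<Longrightarrow> K x y = (\<Sum>r\<in>I. cnj (F r x) * F r y)"
proof -
  have "\<exists>F :: 'a \<Rightarrow> 'a \<Rightarrow> complex. \<forall>x\<in>I. \<forall>y\<in>I. K x y = (\<Sum>r\<in>I. cnj (F r x) * F r y)"
    using assms
  proof (induction I arbitrary: K rule: finite_induct)
    case (insert z I)
    let ?I = "insert z I"
    have fin: "finite ?I" using insert by simp
    define \<kappa> where "\<kappa> = Re (K z z)"
    have K0: "\<kappa> \<ge> 0" "K z z = of_real \<kappa>"
      using psd_on_diag[OF insert.prems fin, of z]
      by (auto simp: \<kappa>_def less_eq_complex_def complex_eq_iff)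
    have herm: "K y x = cnj (K x y)" if "x \<in> ?I" "y \<in> ?I" for x y
      by (rule psd_on_hermitian[OF insert.prems fin that])
    \<comment> \<open>For \<open>\<kappa> = 0\<close> the division gives 0, which is the right row:
      by \<open>psd_on_diag_zero\<close> positivity then forces the whole row of \<open>K\<close> at
      \<open>z\<close> to vanish.\<close>
    define g where "g y = K z y / of_real (sqrt \<kappa>)" for y
    have gg: "cnj (g x) * g y = K x z * K z y / of_real \<kappa>" if "x \<in> I" "y \<in> I" for x y
      using herm[of x z] that K0(1)
      by (simp add: g_def flip: of_real_mult)
    have gz: "cnj (g z) * g y = K z y" if "y \<in> ?I" for y
    proof (cases "\<kappa> = 0")
      case True
      then have "K y z = 0"
        using psd_on_diag_zero[OF insert.prems fin that, of z] K0 by simp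
      then have "K z y = 0"
        using herm[of y z] that by simp
      then show ?thesis by (simp add: g_def)
    next
      case False
      then show ?thesis using K0 by (simp add: g_def divide_simps flip: of_real_mult)
    qed
    have zg: "cnj (g y) * g z = K y z" if "y \<in> ?I" for y
    proof -
      have "cnj (g y) * g z = cnj (cnj (g z) * g y)" by simp
      then show ?thesis using gz[OF that] herm[of z y] that by simp
    qed
    have "psd_on I (\<lambda>x y. K x y - cnj (g x) * g y)"
      unfolding psd_on_def
    proof
      fix v
      define S where "S = (\<Sum>y\<in>I. K z y * v y)"
      define Q where "Q = (\<Sum>x\<in>I. \<Sum>y\<in>I. K x y * v y * cnj (v x))"
      \<comment> \<open>The coordinate at \<open>z\<close> that minimises the form for fixed
        \<open>v\<close>; completing the square turns the form of \<open>K\<close> into that of the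
        Schur complement. For \<open>\<kappa> = 0\<close> it is 0.\<close>
      define u where "u = - S / of_real \<kappa>"
      let ?w = "v(z := u)"
      have S': "(\<Sum>x\<in>I. K x z * cnj (v x)) = cnj S"
        unfolding S_def cnj_sum using herm[of z] by (intro sum.cong) auto
      have "0 \<le> (\<Sum>x\<in>?I. \<Sum>y\<in>?I. K x y * ?w y * cnj (?w x))"
        by (rule psd_onD[OF insert.prems])
      also have "\<dots> = (\<Sum>x\<in>?I. (K x z * u + (\<Sum>y\<in>I. K x y * v y)) * cnj (?w x))"
      proof (rule sum.cong)
        fix x
        have "(\<Sum>y\<in>I. K x y * ?w y * c) = (\<Sum>y\<in>I. K x y * v y) * c" for c
          unfolding sum_distrib_right using insert.hyps by (intro sum.cong) auto
        then show "(\<Sum>y\<in>?I. K x y * ?w y * cnj (?w x)) = (K x z * u + (\<Sum>y\<in>I. K x y * v y)) * cnj (?w x)"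
          using insert.hyps by (simp add: distrib_right)
      qed simp
      also have "\<dots> = (K z z * u + S) * cnj u + (\<Sum>x\<in>I. (K x z * u + (\<Sum>y\<in>I. K x y * v y)) * cnj (?w x))"
        using insert.hyps by (simp add: S_def)
      also have "(\<Sum>x\<in>I. (K x z * u + (\<Sum>y\<in>I. K x y * v y)) * cnj (?w x))
          = (\<Sum>x\<in>I. (K x z * u + (\<Sum>y\<in>I. K x y * v y)) * cnj (v x))"
        using insert.hyps by (intro sum.cong) auto
      also have "\<dots> = u * (\<Sum>x\<in>I. K x z * cnj (v x)) + Q"
        by (simp add: Q_def sum_distrib_left sum_distrib_right sum.distrib algebra_simps)
      also have "(K z z * u + S) * cnj u + (u * (\<Sum>x\<in>I. K x z * cnj (v x)) + Q)
          = K z z * u * cnj u + u * (\<Sum>x\<in>I. K x z * cnj (v x)) + S * cnj u + Q"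
        by (simp add: algebra_simps)
      also have "\<dots> = Q - cnj S * S / of_real \<kappa>"
        unfolding S' K0 u_def by (cases "\<kappa> = 0") (simp_all add: field_simps)
      also have "cnj S * S / of_real \<kappa> = (\<Sum>x\<in>I. \<Sum>y\<in>I. cnj (g x) * g y * v y * cnj (v x))"
        unfolding S'[symmetric] unfolding S_def sum_product sum_divide_distrib
        by (intro sum.cong refl) (simp add: gg)
      finally show "0 \<le> (\<Sum>x\<in>I. \<Sum>y\<in>I. (K x y - cnj (g x) * g y) * v y * cnj (v x))"
        by (simp add: Q_def sum_subtractf algebra_simps)
    qed
    from insert.IH[OF this] obtain F where F:
      "\<And>x y. x \<in> I \<Longrightarrow> y \<in> I \<Longrightarrow> K x y - cnj (g x) * g y = (\<Sum>r\<in>I. cnj (F r x) * F r y)"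
      by blast
    \<comment> \<open>Triangular shape: the rows from the induction get a zero in column
      \<open>z\<close>, because the new row \<open>g\<close> alone accounts for row and column
      \<open>z\<close> of \<open>K\<close>.\<close>
    define F' where "F' r y = (if r = z then g y else if y = z then 0 else F r y)" for r y
    have I_F': "(\<Sum>r\<in>I. cnj (F' r x) * F' r y)
        = (if x = z \<or> y = z then 0 else \<Sum>r\<in>I. cnj (F r x) * F r y)" for x y
      using insert.hyps by (auto simp: F'_def intro!: sum.cong sum.neutral)
    have "K x y = (\<Sum>r\<in>?I. cnj (F' r x) * F' r y)" if "x \<in> ?I" "y \<in> ?I" for x y
    proof -
      have "(\<Sum>r\<in>?I. cnj (F' r x) * F' r y) = cnj (g x) * g y + (\<Sum>r\<in>I. cnj (F' r x) * F' r y)"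
        using insert.hyps by (simp add: F'_def)
      also have "\<dots> = K x y"
        unfolding I_F' using that gz[of y] zg[of x] F[of x y] by (auto simp: algebra_simps)
      finally show ?thesis ..
    qed
    then show ?case by blast
  qed simp
  then show thesis using that by blast
qed

text \<open>The inequality 2ab \<le> a^2 + b^2 on the entries of a Cholesky factor. A bound on the
  diagonal therefore bounds the whole kernel.\<close>

lemma psd_on_entry_bound:
  assumes "finite I" "psd_on I K" "x \<in> I" "y \<in> I"
  shows "2 * cmod (K x y) \<le> Re (K x x) + Re (K y y)"
proof -
  obtain F where F: "\<And>x y. x \<in> I \<Longrightarrow> y \<in> I \<Longrightarrow> K x y = (\<Sum>r\<in>I. cnj (F r x) * F r y)"
    using psd_on_cholesky[OF assms(1,2)] by metis
  have diag: "Re (K w w) = (\<Sum>r\<in>I. (cmod (F r w))\<^sup>2)" if "w \<in> I" for w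
    unfolding F[OF that that] by (simp add: cmod_power2 flip: power2_eq_square)
  have "2 * cmod (K x y) \<le> 2 * (\<Sum>r\<in>I. cmod (cnj (F r x) * F r y))"
    unfolding F[OF assms(3,4)] by (simp add: norm_sum)
  also have "\<dots> \<le> (\<Sum>r\<in>I. (cmod (F r x))\<^sup>2 + (cmod (F r y))\<^sup>2)"
    unfolding sum_distrib_left using sum_squares_bound
    by (intro sum_mono) (simp add: norm_mult mult.assoc)
  finally show ?thesis
    using assms by (simp add: diag sum.distrib)
qed

section \<open>Linear images of the positive semidefinite cone\<close>

text \<open>Tychonoff: functions carry the product topology and the set is a product of compact
  squares, so the index type may be infinite. Kernels are uncurried to functions on pairs to fall
  under this.\<close>

lemma compact_bounded_functions:
  "compact {k :: 'a \<Rightarrow> complex. \<forall>z. \<bar>Re (k z)\<bar> \<le> B \<and> \<bar>Im (k z)\<bar> \<le> B}"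
proof -
  let ?Q = "(\<lambda>(a, b). Complex a b) ` ({- B..B} \<times> {- B..B})"
  have "continuous_on ({- B..B} \<times> {- B..B}) (\<lambda>u. Complex (fst u) (snd u))"
    unfolding Complex_eq by (intro continuous_intros)
  then have "compact ?Q"
    by (intro compact_continuous_image compact_Times compact_Icc) (simp add: case_prod_beta)
  then have "compactin (product_topology (\<lambda>_. euclidean) UNIV) (PiE UNIV (\<lambda>_ :: 'a. ?Q))"
    by (simp add: compactin_PiE)
  moreover have "z \<in> ?Q \<longleftrightarrow> \<bar>Re z\<bar> \<le> B \<and> \<bar>Im z\<bar> \<le> B" for z
    by (cases z) (auto simp: image_iff)
  ultimately show ?thesis
    by (simp add: euclidean_product_topology PiE_UNIV_domain Pi_def)
qed

lemma closed_psd_on: "closed {k. psd_on I (\<lambda>x y. k (x, y))}"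
proof -
  have "{k. psd_on I (\<lambda>x y. k (x, y))} =
      (\<Inter>v. {k. 0 \<le> Re (\<Sum>x\<in>I. \<Sum>y\<in>I. k (x, y) * v y * cnj (v x))}
         \<inter> {k. Im (\<Sum>x\<in>I. \<Sum>y\<in>I. k (x, y) * v y * cnj (v x)) = 0})"
    by (auto simp: psd_on_def less_eq_complex_def)
  also have "closed \<dots>"
    by (intro closed_INT ballI closed_Int closed_Collect_le closed_Collect_eq continuous_intros
        continuous_on_product_coordinates)
  finally show ?thesis .
qed

definition lin_fun :: "'a set \<Rightarrow> ('s \<Rightarrow> 'a \<Rightarrow> 'a \<Rightarrow> complex) \<Rightarrow> ('a \<Rightarrow> 'a \<Rightarrow> complex) \<Rightarrow> 's \<Rightarrow> complex" where
  "lin_fun I A K s = (\<Sum>x\<in>I. \<Sum>y\<in>I. A s x y * K x y)"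

lemma lin_fun_cong:
  assumes "\<And>x y. x \<in> I \<Longrightarrow> y \<in> I \<Longrightarrow> K x y = K' x y"
  shows "lin_fun I A K s = lin_fun I A K' s"
  using assms by (simp add: lin_fun_def cong: sum.cong)

lemma lin_fun_zero [simp]: "lin_fun I A (\<lambda>x y. 0) s = 0"
  by (simp add: lin_fun_def)

lemma lin_fun_add: "lin_fun I A (\<lambda>x y. K x y + K' x y) s = lin_fun I A K s + lin_fun I A K' s"
  by (simp add: lin_fun_def sum.distrib algebra_simps)

lemma lin_fun_scale: "lin_fun I A (\<lambda>x y. t * K x y) s = t * lin_fun I A K s"
  by (simp add: lin_fun_def sum_distrib_left algebra_simps)

text \<open>Coercivity bounds the trace, hence all entries, of every kernel at least as good as the
  zero kernel. Only these compete for the minimum, and they lie in a compact set.\<close>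

lemma nearest_psd_image:
  assumes "finite I" "finite S"
    and coercive: "\<And>K. psd_on I K \<Longrightarrow> (\<Sum>x\<in>I. Re (K x x)) \<le> (\<Sum>s\<in>S. cmod (lin_fun I A K s))"
  obtains K\<^sub>0 where "psd_on I K\<^sub>0"
    "\<And>K. psd_on I K \<Longrightarrow>
       (\<Sum>s\<in>S. (cmod (c s - lin_fun I A K\<^sub>0 s))\<^sup>2) \<le> (\<Sum>s\<in>S. (cmod (c s - lin_fun I A K s))\<^sup>2)"
proof -
  define f where "f K = (\<Sum>s\<in>S. (cmod (c s - lin_fun I A K s))\<^sup>2)" for K
  \<comment> \<open>With \<open>t \<le> 1 + t\<^sup>2\<close> for the deviation at \<open>s\<close>,
    the trace of a competitor is at most the sum of \<open>cmod (c s) + 1\<close> plus its objective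
    value, and the latter is at most the value at the zero kernel.\<close>
  define B where "B = (\<Sum>s\<in>S. cmod (c s) + 1) + f (\<lambda>x y. 0)"
  have f_nonneg: "0 \<le> f K" for K
    by (simp add: f_def sum_nonneg)
  have "0 \<le> (\<Sum>s\<in>S. cmod (c s) + 1)"
    by (simp add: sum_nonneg)
  then have B0: "0 \<le> B"
    unfolding B_def using f_nonneg[of "\<lambda>x y. 0"] by linarith
  define X where "X = {k. \<forall>z. \<bar>Re (k z)\<bar> \<le> B \<and> \<bar>Im (k z)\<bar> \<le> B} \<inter> {k. psd_on I (\<lambda>x y. k (x, y))}"
  have compact: "compact X"
    unfolding X_def
    by (intro compact_Int_closed compact_bounded_functions closed_psd_on)
  have zero: "(\<lambda>z. 0) \<in> X"
    using B0 by (simp add: X_def)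
  have cont: "continuous_on X (\<lambda>k. f (\<lambda>x y. k (x, y)))"
    unfolding f_def lin_fun_def
    by (intro continuous_intros continuous_on_product_then_coordinatewise continuous_on_id)
  obtain k0 where k0: "k0 \<in> X"
    and min: "\<And>k. k \<in> X \<Longrightarrow> f (\<lambda>x y. k0 (x, y)) \<le> f (\<lambda>x y. k (x, y))"
    using continuous_attains_inf[OF compact _ cont] zero by blast
  have "f (\<lambda>x y. k0 (x, y)) \<le> f K" if K: "psd_on I K" for K
  proof (cases "f K \<le> f (\<lambda>x y. 0)")
    case True
    have bound: "cmod (K x y) \<le> B" if "x \<in> I" "y \<in> I" for x y
    proof -
      have nonneg: "0 \<le> Re (K z z)" if "z \<in> I" for z
        using psd_on_diag[OF K assms(1) that] by (simp add: less_eq_complex_def)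
      have diag: "Re (K z z) \<le> B" if "z \<in> I" for z
      proof -
        have "Re (K z z) \<le> (\<Sum>x\<in>I. Re (K x x))"
          by (rule member_le_sum) (use that nonneg assms in auto)
        also have "\<dots> \<le> (\<Sum>s\<in>S. cmod (lin_fun I A K s))"
          by (rule coercive[OF K])
        also have "\<dots> \<le> (\<Sum>s\<in>S. cmod (c s) + 1 + (cmod (c s - lin_fun I A K s))\<^sup>2)"
        proof (rule sum_mono)
          fix s
          define t where "t = cmod (c s - lin_fun I A K s)"
          have "cmod (lin_fun I A K s) \<le> cmod (c s) + t"
            unfolding t_def using norm_triangle_sub[of "lin_fun I A K s" "c s"]
            by (simp add: norm_minus_commute)
          moreover have "0 \<le> t"
            by (simp add: t_def)
          then have "t \<le> 1 + t\<^sup>2"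
            using sum_squares_bound[of t 1] by simp
          ultimately show "cmod (lin_fun I A K s) \<le> cmod (c s) + 1 + t\<^sup>2"
            by linarith
        qed
        also have "\<dots> \<le> B"
          using True by (simp add: B_def f_def sum.distrib)
        finally show ?thesis .
      qed
      show ?thesis
        using psd_on_entry_bound[OF assms(1) K that] diag[OF that(1)] diag[OF that(2)] by linarith
    qed
    \<comment> \<open>Values outside \<open>I \<times> I\<close> do not enter the objective, but
      membership in \<open>X\<close> bounds them too, so they are set to 0.\<close>
    define k where "k z = (if z \<in> I \<times> I then K (fst z) (snd z) else 0)" for z
    have kK: "k (x, y) = K x y" if "x \<in> I" "y \<in> I" for x y
      using that by (simp add: k_def)
    have "k \<in> X"
      using bound B0 K psd_on_cong[of I "\<lambda>x y. k (x, y)" K] kK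
      by (auto simp: X_def k_def intro: order_trans[OF abs_Re_le_cmod] order_trans[OF abs_Im_le_cmod])
    then have "f (\<lambda>x y. k0 (x, y)) \<le> f (\<lambda>x y. k (x, y))"
      by (rule min)
    also have "\<dots> = f K"
      unfolding f_def using lin_fun_cong[of I "\<lambda>x y. k (x, y)" K A] kK by simp
    finally show ?thesis .
  next
    case False
    then show ?thesis
      using min[OF zero] by simp
  qed
  with k0 show thesis
    by (intro that[of "\<lambda>x y. k0 (x, y)"]) (auto simp: X_def f_def)
qed

text \<open>Along the ray the squared norm is a quadratic in \<open>t\<close> whose slope at 0 is
  minus twice the real pairing; at a minimum this slope cannot be negative. The range of
  \<open>t\<close> is limited by \<open>\<epsilon>\<close> because a cone element may be scaled by
  \<open>1 - t\<close> only up to \<open>t = 1\<close>.\<close>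

lemma norm_sq_variation:
  assumes "0 < \<epsilon>"
    and min: "\<And>t::real. 0 < t \<Longrightarrow> t < \<epsilon> \<Longrightarrow>
      (\<Sum>s\<in>S. (cmod (R s))\<^sup>2) \<le> (\<Sum>s\<in>S. (cmod (R s - of_real t * y s))\<^sup>2)"
  shows "Re (\<Sum>s\<in>S. cnj (R s) * y s) \<le> 0"
proof (rule ccontr)
  define b where "b = Re (\<Sum>s\<in>S. cnj (R s) * y s)"
  define q where "q = (\<Sum>s\<in>S. (cmod (y s))\<^sup>2)"
  assume "\<not> Re (\<Sum>s\<in>S. cnj (R s) * y s) \<le> 0"
  then have b: "b > 0" by (simp add: b_def)
  have q: "q \<ge> 0" by (simp add: q_def sum_nonneg)
  \<comment> \<open>Small enough for \<open>t * q \<le> b\<close>, which contradicts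
    \<open>2 * b \<le> t * q\<close>; the \<open>q + 1\<close> guards against
    \<open>q = 0\<close>.\<close>
  define t where "t = min (\<epsilon> / 2) (b / (q + 1))"
  have t: "0 < t" "t < \<epsilon>"
    using b q assms(1) by (auto simp: t_def)
  have "(cmod (R s - of_real t * y s))\<^sup>2 = (cmod (R s))\<^sup>2 - 2 * t * Re (cnj (R s) * y s) + t\<^sup>2 * (cmod (y s))\<^sup>2" for s
    unfolding cmod_power2 by (simp add: power2_eq_square algebra_simps)
  then have "(\<Sum>s\<in>S. (cmod (R s - of_real t * y s))\<^sup>2) = (\<Sum>s\<in>S. (cmod (R s))\<^sup>2) - 2 * t * b + t\<^sup>2 * q"
    unfolding b_def q_def Re_sum by (simp only: sum.distrib sum_subtractf sum_distrib_left)
  with min[OF t] have "t * (2 * b) \<le> t * (t * q)"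
    by (simp add: power2_eq_square algebra_simps)
  then have "2 * b \<le> t * q"
    using t by simp
  also have "\<dots> \<le> (b / (q + 1)) * q"
    using q by (intro mult_right_mono) (auto simp: t_def)
  also have "\<dots> \<le> b"
    using b q by (simp add: divide_simps)
  finally show False using b by simp
qed

text \<open>The residual at a nearest point of a closed convex cone is the separating functional
  of the Hahn--Banach theorem.\<close>

lemma psd_image_residual:
  assumes "finite I" "finite S"
    and coercive: "\<And>K. psd_on I K \<Longrightarrow> (\<Sum>x\<in>I. Re (K x x)) \<le> (\<Sum>s\<in>S. cmod (lin_fun I A K s))"
  obtains K\<^sub>0 where "psd_on I K\<^sub>0"
    "\<And>K. psd_on I K \<Longrightarrow> Re (\<Sum>s\<in>S. cnj (c s - lin_fun I A K\<^sub>0 s) * lin_fun I A K s) \<le> 0"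
    "(\<Sum>s\<in>S. (cmod (c s - lin_fun I A K\<^sub>0 s))\<^sup>2) \<le> Re (\<Sum>s\<in>S. cnj (c s - lin_fun I A K\<^sub>0 s) * c s)"
proof -
  obtain K0 where K0: "psd_on I K0" and min: "\<And>K. psd_on I K \<Longrightarrow>
       (\<Sum>s\<in>S. (cmod (c s - lin_fun I A K0 s))\<^sup>2) \<le> (\<Sum>s\<in>S. (cmod (c s - lin_fun I A K s))\<^sup>2)"
    using nearest_psd_image[OF assms, of c] by blast
  define R where "R s = c s - lin_fun I A K0 s" for s
  have 1: "Re (\<Sum>s\<in>S. cnj (R s) * lin_fun I A K s) \<le> 0" if K: "psd_on I K" for K
  proof (rule norm_sq_variation[where \<epsilon> = 1])
    fix t :: real assume "0 < t" "t < 1"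
    then have "psd_on I (\<lambda>x y. K0 x y + of_real t * K x y)"
      by (intro psd_on_add psd_on_scale K0 K) simp
    from min[OF this] show "(\<Sum>s\<in>S. (cmod (R s))\<^sup>2) \<le> (\<Sum>s\<in>S. (cmod (R s - of_real t * lin_fun I A K s))\<^sup>2)"
      by (simp add: lin_fun_add lin_fun_scale R_def algebra_simps)
  qed simp
  \<comment> \<open>Variation from \<open>K0\<close> towards the origin. It gives the inequality
    opposite to \<open>1\<close> at \<open>K0\<close> itself, which is how the pairing of the
    residual with \<open>c\<close> comes to dominate its squared norm.\<close>
  have "Re (\<Sum>s\<in>S. cnj (R s) * - lin_fun I A K0 s) \<le> 0"
  proof (rule norm_sq_variation[where \<epsilon> = 1])
    fix t :: real assume t: "0 < t" "t < 1"
    then have "psd_on I (\<lambda>x y. of_real (1 - t) * K0 x y)"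
      by (intro psd_on_scale K0) simp
    from min[OF this] show "(\<Sum>s\<in>S. (cmod (R s))\<^sup>2) \<le> (\<Sum>s\<in>S. (cmod (R s - of_real t * - lin_fun I A K0 s))\<^sup>2)"
      by (simp only: lin_fun_scale R_def) (simp add: algebra_simps)
  qed simp
  then have 2: "0 \<le> Re (\<Sum>s\<in>S. cnj (R s) * lin_fun I A K0 s)"
    by (simp add: sum_negf)
  have "complex_of_real ((cmod (R s))\<^sup>2) = cnj (R s) * R s" for s
    by (metis complex_norm_square mult.commute)
  then have "(cmod (R s))\<^sup>2 = Re (cnj (R s) * R s)" for s
    by (metis Re_complex_of_real)
  then have "(\<Sum>s\<in>S. (cmod (R s))\<^sup>2) = Re (\<Sum>s\<in>S. cnj (R s) * R s)"
    by simp
  also have "\<dots> = Re (\<Sum>s\<in>S. cnj (R s) * c s) - Re (\<Sum>s\<in>S. cnj (R s) * lin_fun I A K0 s)"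
    unfolding minus_complex.sel(1)[symmetric] sum_subtractf[symmetric]
    by (rule arg_cong[where f=Re], intro sum.cong refl) (simp add: R_def algebra_simps)
  finally have "(\<Sum>s\<in>S. (cmod (R s))\<^sup>2) \<le> Re (\<Sum>s\<in>S. cnj (R s) * c s)"
    using 2 by linarith
  with K0 1 show thesis
    by (intro that[of K0]) (auto simp: R_def)
qed

section \<open>Block matrices, Toeplitz matrices and trigonometric polynomials\<close>

lemma mat_adjoint_carrier: "A \<in> carrier_mat m n \<Longrightarrow> mat_adjoint A \<in> carrier_mat n m"
  unfolding mat_adjoint_def carrier_mat_def by auto

lemma mat_adjoint_index:
  assumes "A \<in> carrier_mat m n" "i < n" "j < m"
  shows "mat_adjoint A $$ (i, j) = cnj (A $$ (j, i))"
  using assms unfolding mat_adjoint_def by (auto simp: mat_of_rows_index)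

lemma mult_mat_index:
  fixes A B :: "'a :: semiring_0 mat"
  assumes "A \<in> carrier_mat m l" "B \<in> carrier_mat l n" "i < m" "j < n"
  shows "(A * B) $$ (i, j) = (\<Sum>r<l. A $$ (i, r) * B $$ (r, j))"
  using assms by (simp add: scalar_prod_def atLeast0LessThan)

lemma adjoint_mult_index:
  assumes "A \<in> carrier_mat m n" "B \<in> carrier_mat m n" "p < n" "q < n"
  shows "(mat_adjoint A * B) $$ (p, q) = (\<Sum>r<m. cnj (A $$ (r, p)) * B $$ (r, q))"
proof -
  have "(mat_adjoint A * B) $$ (p, q) = (\<Sum>r<m. mat_adjoint A $$ (p, r) * B $$ (r, q))"
    by (rule mult_mat_index[OF mat_adjoint_carrier[OF assms(1)] assms(2-4)])
  then show ?thesis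
    using assms by (simp add: mat_adjoint_index)
qed

lemma psd_mat_iff:
  "psd_mat N A \<longleftrightarrow> A \<in> carrier_mat N N \<and> psd_on {..<N} (\<lambda>i j. A $$ (i, j))"
proof (cases "A \<in> carrier_mat N N")
  case True
  have form: "(A *\<^sub>v v) \<bullet>c v = (\<Sum>i<N. \<Sum>j<N. A $$ (i, j) * v $ j * cnj (v $ i))"
    if "v \<in> carrier_vec N" for v
    using that True by (simp add: scalar_prod_def atLeast0LessThan sum_distrib_right)
  have "psd_on {..<N} (\<lambda>i j. A $$ (i, j))" if psd: "psd_mat N A"
    unfolding psd_on_def
  proof
    fix v
    have "0 \<le> (A *\<^sub>v vec N v) \<bullet>c vec N v"
      using psd by (simp add: psd_mat_def)
    then show "0 \<le> (\<Sum>x<N. \<Sum>y<N. A $$ (x, y) * v y * cnj (v x))"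
      by (simp add: form)
  qed
  moreover have "psd_mat N A" if psd: "psd_on {..<N} (\<lambda>i j. A $$ (i, j))"
    unfolding psd_mat_def using True form psd_onD[OF psd] by simp
  ultimately show ?thesis
    using True by blast
qed (simp add: psd_mat_def)

lemma mult_add_less_mult:
  fixes a b k d :: nat
  assumes "a < k" "b < d"
  shows "a * d + b < k * d"
proof -
  have "a * d + b < (a + 1) * d"
    using assms by simp
  also have "\<dots> \<le> k * d"
    using assms by (intro mult_le_mono1) simp
  finally show ?thesis .
qed

lemma bij_betw_div_mod: "bij_betw (\<lambda>r. (r div d, r mod d)) {..<k * d} ({..<k} \<times> {..<d::nat})"
proof (cases "d = 0")
  case False
  then show ?thesis
    by (intro bij_betw_byWitness[where f' = "\<lambda>(a, b). a * d + b"])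
       (auto simp: less_mult_imp_div_less mult_add_less_mult)
qed (simp add: bij_betw_def)

text \<open>Flattening is a relabelling by \<open>div\<close> and \<open>mod\<close>; positivity of
  block matrices is argued from here on for kernels on pairs (block, position inside the
  block).\<close>

lemma psd_block_mat_iff:
  "psd_mat (k * d) (block_mat k d X) \<longleftrightarrow>
    psd_on ({..<k} \<times> {..<d}) (\<lambda>x y. X (fst x) (fst y) $$ (snd x, snd y))"
proof -
  have "psd_mat (k * d) (block_mat k d X) \<longleftrightarrow>
      psd_on {..<k * d} (\<lambda>r c. X (r div d) (c div d) $$ (r mod d, c mod d))"
    using psd_on_cong[of "{..<k * d}" "\<lambda>i j. block_mat k d X $$ (i, j)"
        "\<lambda>r c. X (r div d) (c div d) $$ (r mod d, c mod d)"]
    by (simp add: psd_mat_iff block_mat_def)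
  also have "\<dots> \<longleftrightarrow> psd_on ({..<k} \<times> {..<d}) (\<lambda>x y. X (fst x) (fst y) $$ (snd x, snd y))"
    by (subst psd_on_reindex[OF bij_betw_div_mod]) simp
  finally show ?thesis .
qed

section \<open>Bases of the Toeplitz matrices and of the full matrix space\<close>

definition toep_unit :: "nat \<Rightarrow> int \<Rightarrow> complex mat" where
  "toep_unit d k = mat d d (\<lambda>(i, j). if int j - int i = k then 1 else 0)"

lemma toep_unit_carrier [simp]: "toep_unit d k \<in> carrier_mat d d"
  by (simp add: toep_unit_def)

lemma toep_unit_toeplitz [simp]: "toep_unit d k \<in> toeplitz d"
  unfolding toep_unit_def toeplitz_def
  by (auto intro!: exI[of _ "\<lambda>m. if - m = k then 1 else 0"] eq_matI)

lemma toeplitz_carrier: "toeplitz d \<subseteq> carrier_mat d d"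
  by (auto simp: toeplitz_def)

lemma one_mat_toep_unit: "1\<^sub>m d = toep_unit d 0"
  by (auto simp: toep_unit_def intro!: eq_matI)

lemma shift_mat_carrier: "shift_mat d \<in> carrier_mat d d"
  by (simp add: shift_mat_def)

text \<open>Each further factor moves the diagonal one step to the right. Frequency is column minus
  row, whereas the symbol of a Toeplitz matrix is indexed by row minus column; hence the
  \<open>a (- k)\<close> in later expansions.\<close>

lemma shift_mat_pow: "shift_mat d ^\<^sub>m k = toep_unit d (int k)"
proof (induction k)
  case 0
  then show ?case
    by (simp add: one_mat_toep_unit[symmetric] shift_mat_def)
next
  case (Suc k)
  show ?case
  proof (rule eq_matI)
    fix i j assume "i < dim_row (toep_unit d (int (Suc k)))" "j < dim_col (toep_unit d (int (Suc k)))"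
    then have ij: "i < d" "j < d"
      by (auto simp: toep_unit_def)
    have "(shift_mat d ^\<^sub>m Suc k) $$ (i, j) = (\<Sum>l<d. toep_unit d (int k) $$ (i, l) * shift_mat d $$ (l, j))"
      by (simp only: pow_mat.simps Suc mult_mat_index[OF toep_unit_carrier shift_mat_carrier ij])
    also have "\<dots> = (\<Sum>l<d. if l = i + k then (if j = l + 1 then 1 else 0) else 0)"
      using ij by (intro sum.cong) (auto simp: shift_mat_def toep_unit_def)
    also have "\<dots> = (if j = i + k + 1 then 1 else 0)"
      using ij by (auto simp: sum.delta)
    finally show "(shift_mat d ^\<^sub>m Suc k) $$ (i, j) = toep_unit d (int (Suc k)) $$ (i, j)"
      using ij by (auto simp: toep_unit_def)
  qed (use shift_mat_carrier[of d] in \<open>auto simp: toep_unit_def pow_mat_dim_square\<close>)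
qed

lemma adjoint_shift_mat_pow: "mat_adjoint (shift_mat d) ^\<^sub>m k = toep_unit d (- int k)"
proof (induction k)
  case 0
  then show ?case
    using mat_adjoint_carrier[OF shift_mat_carrier[of d]]
    by (simp add: one_mat_toep_unit[symmetric])
next
  case (Suc k)
  note car = mat_adjoint_carrier[OF shift_mat_carrier[of d]]
  show ?case
  proof (rule eq_matI)
    fix i j assume "i < dim_row (toep_unit d (- int (Suc k)))" "j < dim_col (toep_unit d (- int (Suc k)))"
    then have ij: "i < d" "j < d"
      by (auto simp: toep_unit_def)
    have "(mat_adjoint (shift_mat d) ^\<^sub>m Suc k) $$ (i, j) =
        (\<Sum>l<d. toep_unit d (- int k) $$ (i, l) * mat_adjoint (shift_mat d) $$ (l, j))"
      by (simp only: pow_mat.simps Suc mult_mat_index[OF toep_unit_carrier car ij])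
    also have "\<dots> = (\<Sum>l<d. if l = j + 1 then (if i = l + k then 1 else 0) else 0)"
      using ij mat_adjoint_index[OF shift_mat_carrier[of d]]
      by (intro sum.cong) (auto simp: shift_mat_def toep_unit_def)
    also have "\<dots> = (if i = j + k + 1 then 1 else 0)"
      using ij by (auto simp: sum.delta)
    finally show "(mat_adjoint (shift_mat d) ^\<^sub>m Suc k) $$ (i, j) = toep_unit d (- int (Suc k)) $$ (i, j)"
      using ij by (auto simp: toep_unit_def)
  qed (use car in \<open>auto simp: toep_unit_def pow_mat_dim_square\<close>)
qed

text \<open>Stated for a subspace \<open>S\<close> so that it serves Toeplitz matrices and all
  matrices alike. Membership of the partial sums is carried through the induction because
  \<open>\<phi>\<close> is linear on \<open>S\<close> only.\<close>

lemma linear_mat_map_sum: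
  assumes lin: "linear_mat_map S n \<phi>" and "S \<subseteq> carrier_mat d d" "0\<^sub>m d d \<in> S"
    and add: "\<And>A B. A \<in> S \<Longrightarrow> B \<in> S \<Longrightarrow> A + B \<in> S"
    and smult: "\<And>c A. A \<in> S \<Longrightarrow> c \<cdot>\<^sub>m A \<in> S"
    and "finite U" "\<And>u. u \<in> U \<Longrightarrow> B u \<in> S" "p < n" "q < n"
  shows "mat_sum d d (\<lambda>u. w u \<cdot>\<^sub>m B u) U \<in> S \<and>
    \<phi> (mat_sum d d (\<lambda>u. w u \<cdot>\<^sub>m B u) U) $$ (p, q) = (\<Sum>u\<in>U. w u * \<phi> (B u) $$ (p, q))"
  using assms(6,7)
proof (induction U)
  case empty
  have "mat_sum d d (\<lambda>u. w u \<cdot>\<^sub>m B u) {} = 0 \<cdot>\<^sub>m 0\<^sub>m d d"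
    by (auto simp: mat_sum_def intro!: eq_matI)
  moreover have "\<phi> (0 \<cdot>\<^sub>m 0\<^sub>m d d) = 0 \<cdot>\<^sub>m \<phi> (0\<^sub>m d d)" and "\<phi> (0\<^sub>m d d) \<in> carrier_mat n n"
    using lin assms(3) by (auto simp only: linear_mat_map_def)
  ultimately show ?case
    using assms(3,8,9) smult[OF assms(3), of 0] by (simp only: index_smult_mat carrier_matD sum.empty mult_zero_left)
next
  case (insert u U)
  let ?M = "mat_sum d d (\<lambda>u. w u \<cdot>\<^sub>m B u) U"
  have M: "?M \<in> S" "\<phi> ?M $$ (p, q) = (\<Sum>u\<in>U. w u * \<phi> (B u) $$ (p, q))"
    using insert by auto
  have u: "B u \<in> S" "w u \<cdot>\<^sub>m B u \<in> S"
    using insert.prems smult by auto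
  have "B u \<in> carrier_mat d d"
    using u assms(2) by auto
  then have eq: "mat_sum d d (\<lambda>u. w u \<cdot>\<^sub>m B u) (insert u U) = w u \<cdot>\<^sub>m B u + ?M"
    using insert.hyps by (auto simp: mat_sum_def intro!: eq_matI)
  have "\<phi> (w u \<cdot>\<^sub>m B u + ?M) = w u \<cdot>\<^sub>m \<phi> (B u) + \<phi> ?M" "\<phi> (B u) \<in> carrier_mat n n" "\<phi> ?M \<in> carrier_mat n n"
    using lin u M by (auto simp: linear_mat_map_def)
  then show ?case
    unfolding eq using add[OF u(2) M(1)] M insert.hyps assms(8,9) by simp
qed

lemma linear_mat_map_toeplitz:
  assumes lin: "linear_mat_map (toeplitz d) n \<phi>" "p < n" "q < n"
  shows "\<phi> (mat d d (\<lambda>(i, j). a (int i - int j))) $$ (p, q) =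
    (\<Sum>k\<in>{- int d<..<int d}. a (- k) * \<phi> (toep_unit d k) $$ (p, q))"
proof -
  let ?D = "{- int d<..<int d}"
  have zero: "0\<^sub>m d d \<in> toeplitz d"
    unfolding toeplitz_def by (auto intro!: exI[of _ "\<lambda>_. 0"] eq_matI)
  have add: "A + B \<in> toeplitz d" if "A \<in> toeplitz d" "B \<in> toeplitz d" for A B
  proof -
    from that(1) obtain a where "A = mat d d (\<lambda>(i, j). a (int i - int j))"
      unfolding toeplitz_def by blast
    moreover from that(2) obtain b where "B = mat d d (\<lambda>(i, j). b (int i - int j))"
      unfolding toeplitz_def by blast
    ultimately show ?thesis
      unfolding toeplitz_def by (auto intro!: exI[of _ "\<lambda>m. a m + b m"] eq_matI)
  qed
  have smult: "c \<cdot>\<^sub>m A \<in> toeplitz d" if "A \<in> toeplitz d" for c A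
  proof -
    from that obtain a where "A = mat d d (\<lambda>(i, j). a (int i - int j))"
      unfolding toeplitz_def by blast
    then show ?thesis
      unfolding toeplitz_def by (auto intro!: exI[of _ "\<lambda>m. c * a m"] eq_matI)
  qed
  have eq: "mat d d (\<lambda>(i, j). a (int i - int j)) = mat_sum d d (\<lambda>k. a (- k) \<cdot>\<^sub>m toep_unit d k) ?D"
  proof (rule eq_matI)
    fix i j assume "i < dim_row (mat_sum d d (\<lambda>k. a (- k) \<cdot>\<^sub>m toep_unit d k) ?D)"
      "j < dim_col (mat_sum d d (\<lambda>k. a (- k) \<cdot>\<^sub>m toep_unit d k) ?D)"
    then have ij: "i < d" "j < d"
      by (auto simp: mat_sum_def)
    have "mat_sum d d (\<lambda>k. a (- k) \<cdot>\<^sub>m toep_unit d k) ?D $$ (i, j)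
        = (\<Sum>k\<in>?D. (a (- k) \<cdot>\<^sub>m toep_unit d k) $$ (i, j))"
      using ij by (simp add: mat_sum_def)
    also have "\<dots> = (\<Sum>k\<in>?D. if int j - int i = k then a (- k) else 0)"
      using ij by (intro sum.cong) (auto simp: toep_unit_def)
    also have "\<dots> = a (int i - int j)"
      using ij by (simp add: sum.delta')
    finally show "mat d d (\<lambda>(i, j). a (int i - int j)) $$ (i, j) =
        mat_sum d d (\<lambda>k. a (- k) \<cdot>\<^sub>m toep_unit d k) ?D $$ (i, j)"
      using ij by simp
  qed (auto simp: mat_sum_def)
  show ?thesis
    unfolding eq
    by (rule linear_mat_map_sum[THEN conjunct2, OF lin(1) toeplitz_carrier zero add smult _ _ assms(2,3)])
       simp_all
qed

definition mat_unit :: "nat \<Rightarrow> nat \<Rightarrow> nat \<Rightarrow> complex mat" where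
  "mat_unit d i j = mat d d (\<lambda>(a, b). if a = i \<and> b = j then 1 else 0)"

lemma mat_unit_carrier [simp]: "mat_unit d i j \<in> carrier_mat d d"
  by (simp add: mat_unit_def)

lemma linear_mat_map_full:
  assumes lin: "linear_mat_map (carrier_mat d d) n \<phi>" "p < n" "q < n" and A: "A \<in> carrier_mat d d"
  shows "\<phi> A $$ (p, q) = (\<Sum>i<d. \<Sum>j<d. A $$ (i, j) * \<phi> (mat_unit d i j) $$ (p, q))"
proof -
  let ?B = "\<lambda>u. mat_unit d (fst u) (snd u)" and ?w = "\<lambda>u. A $$ u" and ?U = "{..<d} \<times> {..<d}"
  have eq: "A = mat_sum d d (\<lambda>u. ?w u \<cdot>\<^sub>m ?B u) ?U"
  proof (rule eq_matI)
    fix i j assume "i < dim_row (mat_sum d d (\<lambda>u. ?w u \<cdot>\<^sub>m ?B u) ?U)"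
      "j < dim_col (mat_sum d d (\<lambda>u. ?w u \<cdot>\<^sub>m ?B u) ?U)"
    then have ij: "i < d" "j < d"
      by (auto simp: mat_sum_def)
    have "mat_sum d d (\<lambda>u. ?w u \<cdot>\<^sub>m ?B u) ?U $$ (i, j) = (\<Sum>u\<in>?U. (?w u \<cdot>\<^sub>m ?B u) $$ (i, j))"
      using ij by (simp add: mat_sum_def)
    also have "\<dots> = (\<Sum>u\<in>?U. if (i, j) = u then A $$ u else 0)"
      using ij by (intro sum.cong) (auto simp: mat_unit_def)
    also have "\<dots> = A $$ (i, j)"
      using ij by (simp add: sum.delta')
    finally show "A $$ (i, j) = mat_sum d d (\<lambda>u. ?w u \<cdot>\<^sub>m ?B u) ?U $$ (i, j)" ..
  qed (use A in \<open>auto simp: mat_sum_def\<close>)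
  have "\<phi> A $$ (p, q) = \<phi> (mat_sum d d (\<lambda>u. ?w u \<cdot>\<^sub>m ?B u) ?U) $$ (p, q)"
    using eq by (rule arg_cong)
  also have "\<dots> = (\<Sum>u\<in>?U. ?w u * \<phi> (?B u) $$ (p, q))"
    by (rule linear_mat_map_sum[THEN conjunct2, OF lin(1) subset_refl _ _ _ _ _ assms(2,3)]) simp_all
  finally show ?thesis
    by (simp add: sum.cartesian_product')
qed

text \<open>Regrouping by \<open>j - i\<close>. It collects a product of polynomials on the circle
  into Laurent coefficients and, with the symbol of a Toeplitz matrix as \<open>h\<close>, shows
  that only diagonal sums of \<open>M\<close> matter.\<close>

lemma sum_by_diagonal:
  fixes h :: "int \<Rightarrow> 'a :: comm_semiring_1"
  shows "(\<Sum>i<d. \<Sum>j<d. h (int j - int i) * M i j) =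
    (\<Sum>k\<in>{- int d<..<int d}. h k * (\<Sum>i<d. \<Sum>j<d. if int j - int i = k then M i j else 0))"
proof -
  let ?D = "{- int d<..<int d}"
  have "(\<Sum>k\<in>?D. h k * (\<Sum>i<d. \<Sum>j<d. if int j - int i = k then M i j else 0))
      = (\<Sum>k\<in>?D. \<Sum>i<d. \<Sum>j<d. if int j - int i = k then h k * M i j else 0)"
    unfolding sum_distrib_left by (intro sum.cong refl) auto
  also have "\<dots> = (\<Sum>i<d. \<Sum>k\<in>?D. \<Sum>j<d. if int j - int i = k then h k * M i j else 0)"
    by (rule sum.swap)
  also have "\<dots> = (\<Sum>i<d. \<Sum>j<d. \<Sum>k\<in>?D. if int j - int i = k then h k * M i j else 0)"
    by (intro sum.cong refl sum.swap)
  also have "\<dots> = (\<Sum>i<d. \<Sum>j<d. h (int j - int i) * M i j)"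
    by (intro sum.cong refl) (auto simp: sum.delta')
  finally show ?thesis ..
qed

section \<open>Trigonometric polynomials are determined by their values on the circle\<close>

lemma infinite_unit_circle: "infinite {z :: complex. cmod z = 1}"
proof
  assume "finite {z :: complex. cmod z = 1}"
  moreover have "inj_on cis {0<..<1}"
  proof (rule inj_onI)
    fix x y assume xy: "x \<in> {0<..<1::real}" "y \<in> {0<..<1::real}" "cis x = cis y"
    then have "cos x = cos y" "0 \<le> x" "x \<le> pi" "0 \<le> y" "y \<le> pi"
      using pi_ge_two by (auto simp: cis.ctr)
    then show "x = y"
      using cos_inj_pi by blast
  qed
  moreover have "cis ` {0<..<1} \<subseteq> {z. cmod z = 1}"
    by auto
  ultimately have "finite {0<..<1::real}"
    by (metis finite_imageD finite_subset)
  then show False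
    by (simp add: infinite_Ioo)
qed

text \<open>Multiplication by \<open>z ^ d\<close> makes every exponent \<open>k + d\<close>
  positive, so the difference becomes an ordinary polynomial; it has infinitely many zeros, namely
  the whole circle.\<close>

lemma trig_poly_unique:
  fixes a b :: "int \<Rightarrow> complex"
  assumes "\<And>z. cmod z = 1 \<Longrightarrow>
      (\<Sum>k\<in>{- int d<..<int d}. a k * z powi k) = (\<Sum>k\<in>{- int d<..<int d}. b k * z powi k)"
    and k: "k \<in> {- int d<..<int d}"
  shows "a k = b k"
proof -
  let ?D = "{- int d<..<int d}"
  define P where "P = (\<Sum>k\<in>?D. monom (a k - b k) (nat (k + int d)))"
  have "poly P z = 0" if z: "cmod z = 1" for z
  proof -
    have "z \<noteq> 0" using z by auto
    then have shift: "z ^ nat (k + int d) = z powi k * z ^ d" if "k \<in> ?D" for k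
    proof -
      have "z ^ nat (k + int d) = z powi (k + int d)"
        using that by (simp add: power_int_def)
      also have "\<dots> = z powi k * z powi int d"
        using \<open>z \<noteq> 0\<close> by (intro power_int_add) simp
      finally show ?thesis by simp
    qed
    have "poly P z = z ^ d * (\<Sum>k\<in>?D. (a k - b k) * z powi k)"
      unfolding P_def poly_sum sum_distrib_left
      by (intro sum.cong refl) (simp only: poly_monom shift mult_ac)
    also have "\<dots> = 0"
      using assms(1)[OF z] by (simp add: algebra_simps sum_subtractf)
    finally show ?thesis .
  qed
  then have "{z. cmod z = 1} \<subseteq> {z. poly P z = 0}"
    by auto
  then have "P = 0"
    using infinite_unit_circle poly_roots_finite finite_subset by blast
  then have "0 = coeff P (nat (k + int d))"
    by simp
  also have "\<dots> = (\<Sum>l\<in>?D. if k = l then a l - b l else 0)"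
    unfolding P_def coeff_sum using k by (intro sum.cong) auto
  also have "\<dots> = a k - b k"
    using k by (simp add: sum.delta')
  finally show ?thesis by simp
qed

section \<open>Fejer--Riesz factors as Gram representations\<close>

text \<open>When \<open>M i j\<close> is a fixed entry of \<open>mat_adjoint (F i) * F j\<close>,
  this is the coefficient at \<open>z powi k\<close> of that entry of the square of the polynomial
  on the circle.\<close>

definition diag_sum :: "nat \<Rightarrow> (nat \<Rightarrow> nat \<Rightarrow> complex) \<Rightarrow> int \<Rightarrow> complex" where
  "diag_sum d M k = (\<Sum>i<d. \<Sum>j<d. if int j - int i = k then M i j else 0)"

lemma diag_sum_cong:
  assumes "\<And>i j. i < d \<Longrightarrow> j < d \<Longrightarrow> M i j = M' i j"
  shows "diag_sum d M k = diag_sum d M' k"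
  unfolding diag_sum_def using assms by (intro sum.cong refl) auto

lemma poly_density_index:
  assumes lin: "linear_mat_map (toeplitz d) n \<phi>" and "1 \<le> d" "p < n" "q < n"
  shows "poly_density d n \<phi> z $$ (p, q) =
    (\<Sum>k\<in>{- int d<..<int d}. \<phi> (toep_unit d k) $$ (p, q) * z powi k)"
proof -
  have car: "\<phi> (toep_unit d k) \<in> carrier_mat n n" for k
    using lin by (simp add: linear_mat_map_def)
  let ?f = "\<lambda>k. \<phi> (toep_unit d k) $$ (p, q) * z powi k"
  have D: "{- int d<..<int d} = insert 0 (int ` {1..<d} \<union> (\<lambda>k. - int k) ` {1..<d})"
  proof (intro equalityI subsetI)
    fix x assume x: "x \<in> {- int d<..<int d}"
    consider "x = 0" | "x > 0" | "x < 0" by linarith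
    then show "x \<in> insert 0 (int ` {1..<d} \<union> (\<lambda>k. - int k) ` {1..<d})"
    proof cases
      case 2
      then have "x = int (nat x)" "nat x \<in> {1..<d}" using x by auto
      then show ?thesis by blast
    next
      case 3
      then have "x = - int (nat (- x))" "nat (- x) \<in> {1..<d}" using x by auto
      then show ?thesis by blast
    qed simp
  qed (use assms(2) in auto)
  have "(\<Sum>k\<in>{- int d<..<int d}. ?f k) = ?f 0 + ((\<Sum>k\<in>int ` {1..<d}. ?f k) + (\<Sum>k\<in>(\<lambda>k. - int k) ` {1..<d}. ?f k))"
    unfolding D by (subst sum.insert) (auto intro!: sum.union_disjoint)
  also have "(\<Sum>k\<in>int ` {1..<d}. ?f k) = (\<Sum>k\<in>{1..<d}. ?f (int k))"
    by (simp add: sum.reindex)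
  also have "(\<Sum>k\<in>(\<lambda>k. - int k) ` {1..<d}. ?f k) = (\<Sum>k\<in>{1..<d}. ?f (- int k))"
    by (subst sum.reindex) (auto simp: inj_on_def)
  finally show ?thesis
    unfolding poly_density_def shift_mat_pow adjoint_shift_mat_pow one_mat_toep_unit
    using car[THEN carrier_matD(1)] car[THEN carrier_matD(2)] assms(3,4)
    by (simp add: mat_sum_def mult_ac)
qed

lemma cnj_eq_inverse:
  assumes "cmod z = 1"
  shows "cnj z = inverse z"
proof -
  have "cnj z * z = 1"
    using assms by (metis complex_norm_square mult.commute of_real_1 one_power2)
  then show ?thesis
    by (metis inverse_unique mult.commute)
qed

text \<open>On the circle conjugation inverts \<open>z\<close>, so
  \<open>cnj (z ^ i) * z ^ j\<close> depends only on \<open>j - i\<close> and the products of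
  coefficients collect along diagonals.\<close>

lemma mat_poly_square_index:
  assumes F: "\<And>j. j < d \<Longrightarrow> F j \<in> carrier_mat m n" and "p < n" "q < n" and z: "cmod z = 1"
  shows "(mat_adjoint (mat_poly_eval d m n F z) * mat_poly_eval d m n F z) $$ (p, q) =
    (\<Sum>k\<in>{- int d<..<int d}. diag_sum d (\<lambda>i j. (mat_adjoint (F i) * F j) $$ (p, q)) k * z powi k)"
proof -
  have z0: "z \<noteq> 0" using z by auto
  note cnj_z = cnj_eq_inverse[OF z]
  have zz: "cnj (z ^ i) * z ^ j = z powi (int j - int i)" for i j
    using z0 by (simp add: cnj_z power_int_diff divide_inverse power_inverse)
  have car: "mat_poly_eval d m n F z \<in> carrier_mat m n"
    by (simp add: mat_poly_eval_def mat_sum_def)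
  have entry: "mat_poly_eval d m n F z $$ (r, s) = (\<Sum>j<d. z ^ j * F j $$ (r, s))" if "r < m" "s < n" for r s
    unfolding mat_poly_eval_def mat_sum_def using that F[THEN carrier_matD(1)] F[THEN carrier_matD(2)]
    by (simp cong: sum.cong_simp)
  have "(mat_adjoint (mat_poly_eval d m n F z) * mat_poly_eval d m n F z) $$ (p, q)
      = (\<Sum>r<m. cnj (\<Sum>i<d. z ^ i * F i $$ (r, p)) * (\<Sum>j<d. z ^ j * F j $$ (r, q)))"
    using assms(2,3) by (simp add: adjoint_mult_index[OF car car] entry)
  also have "\<dots> = (\<Sum>r<m. \<Sum>i<d. \<Sum>j<d. z powi (int j - int i) * (cnj (F i $$ (r, p)) * F j $$ (r, q)))"
    unfolding cnj_sum sum_product by (intro sum.cong refl) (simp flip: zz add: mult_ac)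
  also have "\<dots> = (\<Sum>i<d. \<Sum>r<m. \<Sum>j<d. z powi (int j - int i) * (cnj (F i $$ (r, p)) * F j $$ (r, q)))"
    by (rule sum.swap)
  also have "\<dots> = (\<Sum>i<d. \<Sum>j<d. \<Sum>r<m. z powi (int j - int i) * (cnj (F i $$ (r, p)) * F j $$ (r, q)))"
    by (intro sum.cong refl sum.swap)
  also have "\<dots> = (\<Sum>i<d. \<Sum>j<d. z powi (int j - int i) * (mat_adjoint (F i) * F j) $$ (p, q))"
    using assms(2,3) by (intro sum.cong refl) (simp add: adjoint_mult_index[OF F F] sum_distrib_left)
  also have "\<dots> = (\<Sum>k\<in>{- int d<..<int d}. z powi k * diag_sum d (\<lambda>i j. (mat_adjoint (F i) * F j) $$ (p, q)) k)"
    unfolding diag_sum_def by (rule sum_by_diagonal)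
  finally show ?thesis
    by (simp add: mult.commute)
qed

text \<open>Uniqueness of Laurent coefficients trades the identity in \<open>z\<close> for finitely
  many linear conditions on the Gram matrix, the same conditions that say that a map with this Choi
  matrix extends \<open>\<phi>\<close>.\<close>

lemma fejer_riesz_factor_iff:
  assumes lin: "linear_mat_map (toeplitz d) n \<phi>" and "1 \<le> d"
  shows "fejer_riesz_factor d n \<phi> m F \<longleftrightarrow> (\<forall>j<d. F j \<in> carrier_mat m n) \<and>
    (\<forall>k\<in>{- int d<..<int d}. \<forall>p<n. \<forall>q<n.
       \<phi> (toep_unit d k) $$ (p, q) = diag_sum d (\<lambda>i j. (mat_adjoint (F i) * F j) $$ (p, q)) k)"
    (is "?L \<longleftrightarrow> ?C \<and> ?R")
proof (cases ?C)
  case C: True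
  have dims: "poly_density d n \<phi> z \<in> carrier_mat n n" for z
    by (simp add: poly_density_def mat_sum_def)
  have dims': "mat_adjoint (mat_poly_eval d m n F z) * mat_poly_eval d m n F z \<in> carrier_mat n n" for z
    by (intro mult_carrier_mat[of _ _ m] mat_adjoint_carrier) (simp_all add: mat_poly_eval_def mat_sum_def)
  have ?R if L: ?L
  proof (intro ballI allI impI)
    fix k p q assume k: "k \<in> {- int d<..<int d}" and pq: "p < n" "q < n"
    show "\<phi> (toep_unit d k) $$ (p, q) = diag_sum d (\<lambda>i j. (mat_adjoint (F i) * F j) $$ (p, q)) k"
    proof (rule trig_poly_unique[OF _ k])
      fix z :: complex assume z: "cmod z = 1"
      then have "poly_density d n \<phi> z = mat_adjoint (mat_poly_eval d m n F z) * mat_poly_eval d m n F z"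
        using L by (simp add: fejer_riesz_factor_def)
      then show "(\<Sum>k\<in>{- int d<..<int d}. \<phi> (toep_unit d k) $$ (p, q) * z powi k) =
          (\<Sum>k\<in>{- int d<..<int d}. diag_sum d (\<lambda>i j. (mat_adjoint (F i) * F j) $$ (p, q)) k * z powi k)"
        using poly_density_index[OF assms pq, of z] mat_poly_square_index[of d F m n p q z] C pq z by simp
    qed
  qed
  moreover have ?L if R: ?R
    unfolding fejer_riesz_factor_def
  proof (intro conjI C allI impI)
    fix z :: complex assume z: "cmod z = 1"
    show "poly_density d n \<phi> z = mat_adjoint (mat_poly_eval d m n F z) * mat_poly_eval d m n F z"
    proof (rule eq_matI)
      fix p q assume "p < dim_row (mat_adjoint (mat_poly_eval d m n F z) * mat_poly_eval d m n F z)"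
        "q < dim_col (mat_adjoint (mat_poly_eval d m n F z) * mat_poly_eval d m n F z)"
      then have pq: "p < n" "q < n"
        using dims'[of z] by auto
      show "poly_density d n \<phi> z $$ (p, q) =
          (mat_adjoint (mat_poly_eval d m n F z) * mat_poly_eval d m n F z) $$ (p, q)"
        using poly_density_index[OF assms pq, of z] mat_poly_square_index[of d F m n p q z] C R pq z
        by simp
    qed (use dims[of z] dims'[of z] in auto)
  qed
  ultimately show ?thesis
    using C by blast
qed (unfold fejer_riesz_factor_def, blast)

text \<open>The columns of a Cholesky factor, grouped by the block index \<open>j\<close>, are the
  coefficients of a matrix polynomial; its rows are the flattened pairs.\<close>

lemma psd_factor_blocks:
  assumes "psd_on ({..<d} \<times> {..<n}) K"
  obtains F where "\<And>j. F j \<in> carrier_mat (d * n) n"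
    "\<And>i j p q. i < d \<Longrightarrow> j < d \<Longrightarrow> p < n \<Longrightarrow> q < n \<Longrightarrow>
       (mat_adjoint (F i) * F j) $$ (p, q) = K (i, p) (j, q)"
proof -
  let ?I = "{..<d} \<times> {..<n}"
  obtain f where f: "\<And>x y. x \<in> ?I \<Longrightarrow> y \<in> ?I \<Longrightarrow> K x y = (\<Sum>r\<in>?I. cnj (f r x) * f r y)"
    using psd_on_cholesky[OF _ assms] by blast
  define F where "F j = mat (d * n) n (\<lambda>(r, q). f (r div n, r mod n) (j, q))" for j
  have car: "F j \<in> carrier_mat (d * n) n" for j
    by (simp add: F_def)
  have "(mat_adjoint (F i) * F j) $$ (p, q) = K (i, p) (j, q)"
    if "i < d" "j < d" "p < n" "q < n" for i j p q
  proof -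
    have "(mat_adjoint (F i) * F j) $$ (p, q)
        = (\<Sum>r<d * n. cnj (f (r div n, r mod n) (i, p)) * f (r div n, r mod n) (j, q))"
      unfolding adjoint_mult_index[OF car car that(3,4)] using that by (simp add: F_def)
    also have "\<dots> = (\<Sum>r\<in>?I. cnj (f r (i, p)) * f r (j, q))"
      by (rule sum.reindex_bij_betw[OF bij_betw_div_mod])
    also have "\<dots> = K (i, p) (j, q)"
      using f that by simp
    finally show ?thesis .
  qed
  with car show thesis by (rule that)
qed

lemma cp_map_ampliation:
  assumes "cp_map d S n \<phi>" "1 \<le> k" "\<And>i j. i < k \<Longrightarrow> j < k \<Longrightarrow> X i j \<in> S" "psd_mat (k * d) (block_mat k d X)"
  shows "psd_mat (k * n) (block_mat k n (\<lambda>i j. \<phi> (X i j)))"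
  using assms unfolding cp_map_def by blast

text \<open>Positivity makes images of positive matrices self-adjoint, and
  \<open>toep_unit d k\<close> is in general not positive. For \<open>z\<close> on the circle,
  however, the Toeplitz matrix with entries \<open>z powi (int j - int i)\<close> is positive of
  rank one and its image is the density at \<open>z\<close>. A density that is self-adjoint on the
  whole circle has mutually adjoint coefficients at \<open>k\<close> and \<open>- k\<close>.\<close>

lemma toeplitz_map_hermitian:
  assumes cp: "cp_map d (toeplitz d) n \<phi>" and d: "1 \<le> d" and k: "k \<in> {- int d<..<int d}" and pq: "p < n" "q < n"
  shows "\<phi> (toep_unit d (- k)) $$ (q, p) = cnj (\<phi> (toep_unit d k) $$ (p, q))"
proof -
  let ?D = "{- int d<..<int d}"
  have lin: "linear_mat_map (toeplitz d) n \<phi>"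
    using cp by (simp add: cp_map_def)
  have "cnj (\<phi> (toep_unit d (- k)) $$ (q, p)) = \<phi> (toep_unit d k) $$ (p, q)"
  proof (rule trig_poly_unique[OF _ k])
    fix z :: complex assume z: "cmod z = 1"
    then have z0: "z \<noteq> 0" by auto
    note cnj_z = cnj_eq_inverse[OF z]
    have cnj_powi: "cnj z powi l = z powi (- l)" for l
      by (auto simp: power_int_def cnj_z)
    define T where "T = mat d d (\<lambda>(i, j). (\<lambda>m. z powi (- m)) (int i - int j))"
    have T: "T \<in> toeplitz d"
      unfolding T_def toeplitz_def by (rule CollectI, rule exI[of _ "\<lambda>m. z powi (- m)"], rule refl)
    have T_index: "T $$ (i, j) = cnj (z ^ i) * z ^ j" if "i < d" "j < d" for i j
      using that z0 by (simp add: T_def cnj_z power_int_diff divide_inverse power_inverse)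
    have "psd_on ({..<1 :: nat} \<times> {..<d}) (\<lambda>x y. T $$ (snd x, snd y)) \<longleftrightarrow>
        psd_on ({..<1 :: nat} \<times> {..<d}) (\<lambda>x y. cnj (z ^ snd x) * z ^ snd y)"
      by (rule psd_on_cong) (auto simp: T_index)
    from iffD2[OF this psd_on_rank_one] have "psd_mat (1 * d) (block_mat 1 d (\<lambda>_ _. T))"
      by (simp only: psd_block_mat_iff)
    from cp_map_ampliation[OF cp order_refl T this]
    have "psd_mat (1 * n) (block_mat 1 n (\<lambda>_ _. \<phi> T))" .
    then have "psd_on ({..<1 :: nat} \<times> {..<n}) (\<lambda>x y. \<phi> T $$ (snd x, snd y))"
      unfolding psd_block_mat_iff .
    from psd_on_hermitian[OF this, of "(0, q)" "(0, p)"] pq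
    have herm: "\<phi> T $$ (p, q) = cnj (\<phi> T $$ (q, p))"
      by simp
    have eval: "\<phi> T $$ (r, s) = (\<Sum>k\<in>?D. z powi k * \<phi> (toep_unit d k) $$ (r, s))" if "r < n" "s < n" for r s
      using linear_mat_map_toeplitz[OF lin that, of "\<lambda>m. z powi (- m)"] by (simp only: T_def minus_minus)
    have "(\<Sum>k\<in>?D. cnj (\<phi> (toep_unit d (- k)) $$ (q, p)) * z powi k)
        = (\<Sum>k\<in>?D. cnj (\<phi> (toep_unit d k) $$ (q, p)) * z powi (- k))"
      by (rule sum.reindex_bij_witness[where i=uminus and j=uminus]) auto
    also have "\<dots> = cnj (\<phi> T $$ (q, p))"
      unfolding eval[OF pq(2,1)] cnj_sum
      by (intro sum.cong refl) (simp add: cnj_powi)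
    finally show "(\<Sum>k\<in>?D. cnj (\<phi> (toep_unit d (- k)) $$ (q, p)) * z powi k)
        = (\<Sum>k\<in>?D. \<phi> (toep_unit d k) $$ (p, q) * z powi k)"
      unfolding herm[symmetric] eval[OF pq] by (simp add: mult.commute)
  qed
  then show ?thesis
    by (metis complex_cnj_cnj)
qed

section \<open>Existence of a positive Choi matrix\<close>

text \<open>For \<open>s = (k, p, q)\<close> this is the coefficient kernel of the functional that
  reads off the entry \<open>(p, q)\<close> of the sum of the blocks on diagonal \<open>k\<close>,
  in the format of \<open>lin_fun\<close>.\<close>

definition diag_coeff :: "int \<times> nat \<times> nat \<Rightarrow> nat \<times> nat \<Rightarrow> nat \<times> nat \<Rightarrow> complex" where
  "diag_coeff s x y = (if s = (int (fst y) - int (fst x), snd x, snd y) then 1 else 0)"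

abbreviation diag_indices :: "nat \<Rightarrow> nat \<Rightarrow> (int \<times> nat \<times> nat) set" where
  "diag_indices d n \<equiv> {- int d<..<int d} \<times> {..<n} \<times> {..<n}"

lemma lin_fun_diag_coeff:
  assumes "p < n" "q < n"
  shows "lin_fun ({..<d} \<times> {..<n}) diag_coeff K (k, p, q) = diag_sum d (\<lambda>i j. K (i, p) (j, q)) k"
proof -
  have "lin_fun ({..<d} \<times> {..<n}) diag_coeff K (k, p, q)
      = (\<Sum>i<d. \<Sum>p'<n. \<Sum>j<d. \<Sum>q'<n. if q' = q then (if p' = p \<and> int j - int i = k then K (i, p') (j, q') else 0) else 0)"
    unfolding lin_fun_def sum.cartesian_product' by (intro sum.cong refl) (auto simp: diag_coeff_def)
  also have "\<dots> = (\<Sum>i<d. \<Sum>p'<n. if p' = p then (\<Sum>j<d. if int j - int i = k then K (i, p') (j, q) else 0) else 0)"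
    using assms(2) by (intro sum.cong refl) (simp add: sum.delta)
  also have "\<dots> = diag_sum d (\<lambda>i j. K (i, p) (j, q)) k"
    unfolding diag_sum_def using assms(1) by (intro sum.cong[OF refl, of "{..<d}"]) (simp only: sum.delta finite_lessThan lessThan_iff if_True)
  finally show ?thesis .
qed

text \<open>Each pair \<open>(x, y)\<close> lies on exactly one diagonal. The transpose of the map
  taking diagonal sums therefore spreads the family \<open>X\<close> out to a block Toeplitz
  kernel.\<close>

lemma sum_lin_fun_diag_coeff:
  "(\<Sum>s\<in>diag_indices d n. X s * lin_fun ({..<d} \<times> {..<n}) diag_coeff K s) =
    (\<Sum>x\<in>{..<d} \<times> {..<n}. \<Sum>y\<in>{..<d} \<times> {..<n}. X (int (fst y) - int (fst x), snd x, snd y) * K x y)"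
proof -
  let ?I = "{..<d} \<times> {..<n}" and ?S = "diag_indices d n"
  have "(\<Sum>s\<in>?S. X s * lin_fun ?I diag_coeff K s) = (\<Sum>s\<in>?S. \<Sum>x\<in>?I. \<Sum>y\<in>?I. X s * diag_coeff s x y * K x y)"
    by (simp only: lin_fun_def sum_distrib_left mult.assoc)
  also have "\<dots> = (\<Sum>x\<in>?I. \<Sum>s\<in>?S. \<Sum>y\<in>?I. X s * diag_coeff s x y * K x y)"
    by (rule sum.swap)
  also have "\<dots> = (\<Sum>x\<in>?I. \<Sum>y\<in>?I. \<Sum>s\<in>?S. X s * diag_coeff s x y * K x y)"
    by (intro sum.cong refl sum.swap)
  also have "\<dots> = (\<Sum>x\<in>?I. \<Sum>y\<in>?I. X (int (fst y) - int (fst x), snd x, snd y) * K x y)"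
  proof (intro sum.cong refl)
    fix x y assume xy: "x \<in> ?I" "y \<in> ?I"
    let ?s = "(int (fst y) - int (fst x), snd x, snd y)"
    have "(\<Sum>s\<in>?S. X s * diag_coeff s x y * K x y) = (\<Sum>s\<in>?S. if s = ?s then X s * K x y else 0)"
      by (intro sum.cong refl) (simp add: diag_coeff_def)
    also have "\<dots> = X ?s * K x y"
      using xy by (subst sum.delta) auto
    finally show "(\<Sum>s\<in>?S. X s * diag_coeff s x y * K x y) = X ?s * K x y" .
  qed
  finally show ?thesis .
qed

text \<open>The coercivity that the minimisation asks for: the indices \<open>(0, p, p)\<close>
  alone recover the trace, and \<open>1 \<le> d\<close> puts the frequency 0 in range.\<close>

lemma trace_le_diag_norms:
  assumes "1 \<le> d"
  shows "(\<Sum>x\<in>{..<d} \<times> {..<n}. Re (K x x)) \<le>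
    (\<Sum>s\<in>diag_indices d n. cmod (lin_fun ({..<d} \<times> {..<n}) diag_coeff K s))"
proof -
  let ?L = "lin_fun ({..<d} \<times> {..<n}) diag_coeff K"
  have L: "?L (0, p, p) = (\<Sum>i<d. K (i, p) (i, p))" if "p < n" for p
    unfolding lin_fun_diag_coeff[OF that that] diag_sum_def by (intro sum.cong refl) (simp add: sum.delta')
  have "(\<Sum>x\<in>{..<d} \<times> {..<n}. Re (K x x)) = (\<Sum>p<n. \<Sum>i<d. Re (K (i, p) (i, p)))"
    unfolding sum.cartesian_product' by (rule sum.swap)
  also have "\<dots> = (\<Sum>p<n. Re (?L (0, p, p)))"
    by (intro sum.cong refl) (simp add: L)
  also have "\<dots> \<le> (\<Sum>p<n. cmod (?L (0, p, p)))"
    by (intro sum_mono complex_Re_le_cmod)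
  also have "\<dots> = (\<Sum>s\<in>(\<lambda>p. (0, p, p)) ` {..<n}. cmod (?L s))"
    by (subst sum.reindex) (auto simp: inj_on_def)
  also have "\<dots> \<le> (\<Sum>s\<in>diag_indices d n. cmod (?L s))"
    by (intro sum_mono2) (use assms in auto)
  finally show ?thesis .
qed

text \<open>This is where \<open>n\<close>-positivity enters: \<open>\<phi>\<close>, as a functional on block Toeplitz matrices,
  pairs nonnegatively with the positive ones.\<close>

lemma cp_map_toeplitz_pairing:
  assumes cp: "cp_map d (toeplitz d) n \<phi>" and "1 \<le> n"
    and X: "psd_on ({..<d} \<times> {..<n}) (\<lambda>x y. X (int (fst y) - int (fst x), snd x, snd y))"
  shows "0 \<le> (\<Sum>(k, a, b)\<in>diag_indices d n. X (k, a, b) * \<phi> (toep_unit d k) $$ (a, b))"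
proof -
  define T where "T a b = mat d d (\<lambda>(i, j). (\<lambda>m. X (- m, a, b)) (int i - int j))" for a b
  have T: "T a b \<in> toeplitz d" for a b
    unfolding T_def toeplitz_def by (rule CollectI, rule exI[of _ "\<lambda>m. X (- m, a, b)"], rule refl)
  \<comment> \<open>The kernel of \<open>X\<close> has the Toeplitz position as outer index, whereas
    the ampliation of \<open>\<phi>\<close> takes Toeplitz matrices as inner blocks; the two differ
    by an exchange of tensor factors.\<close>
  have "bij_betw prod.swap ({..<n} \<times> {..<d}) ({..<d} \<times> {..<n})"
    by (intro bij_betw_byWitness[where f' = prod.swap]) auto
  from psd_on_reindex[OF this] X
  have "psd_on ({..<n} \<times> {..<d}) (\<lambda>x y. X (int (snd y) - int (snd x), fst x, fst y))"
    by simp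
  moreover have "psd_on ({..<n} \<times> {..<d}) (\<lambda>x y. T (fst x) (fst y) $$ (snd x, snd y)) \<longleftrightarrow>
      psd_on ({..<n} \<times> {..<d}) (\<lambda>x y. X (int (snd y) - int (snd x), fst x, fst y))"
    by (rule psd_on_cong) (auto simp: T_def)
  ultimately have "psd_mat (n * d) (block_mat n d T)"
    by (simp only: psd_block_mat_iff)
  then have "psd_mat (n * n) (block_mat n n (\<lambda>a b. \<phi> (T a b)))"
    by (rule cp_map_ampliation[OF cp \<open>1 \<le> n\<close> T])
  then have "psd_on ({..<n} \<times> {..<n}) (\<lambda>x y. \<phi> (T (fst x) (fst y)) $$ (snd x, snd y))"
    by (simp only: psd_block_mat_iff)
  \<comment> \<open>The test vector is the sum of all e_a \<otimes> e_a: it selects the entry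
    \<open>(a, b)\<close> of block \<open>(a, b)\<close>, and the sum of these entries is the
    pairing.\<close>
  from psd_onD[OF this, of "\<lambda>x. if snd x = fst x then 1 else 0"]
  have "0 \<le> (\<Sum>a<n. \<Sum>p<n. \<Sum>b<n. \<Sum>q<n. \<phi> (T a b) $$ (p, q) * (if q = b then 1 else 0) * cnj (if p = a then 1 else 0))"
    by (simp only: sum.cartesian_product' fst_conv snd_conv)
  also have "\<dots> = (\<Sum>a<n. \<Sum>p<n. if p = a then (\<Sum>b<n. \<phi> (T a b) $$ (p, b)) else 0)"
  proof (intro sum.cong refl)
    fix a p
    show "(\<Sum>b<n. \<Sum>q<n. \<phi> (T a b) $$ (p, q) * (if q = b then 1 else 0) * cnj (if p = a then 1 else 0))
        = (if p = a then (\<Sum>b<n. \<phi> (T a b) $$ (p, b)) else 0)"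
    proof (cases "p = a")
      case True
      have "(\<Sum>q<n. \<phi> (T a b) $$ (p, q) * (if q = b then 1 else 0)) = \<phi> (T a b) $$ (p, b)" if "b < n" for b
      proof -
        have "(\<Sum>q<n. \<phi> (T a b) $$ (p, q) * (if q = b then 1 else 0))
            = (\<Sum>q<n. if q = b then \<phi> (T a b) $$ (p, q) else 0)"
          by (rule sum.cong) auto
        then show ?thesis
          using that by (simp add: sum.delta)
      qed
      with True show ?thesis by simp
    qed simp
  qed
  also have "\<dots> = (\<Sum>a<n. \<Sum>b<n. \<phi> (T a b) $$ (a, b))"
    by (rule sum.cong[OF refl]) (simp only: sum.delta finite_lessThan lessThan_iff if_True)
  also have "\<dots> = (\<Sum>a<n. \<Sum>b<n. \<Sum>k\<in>{- int d<..<int d}. X (k, a, b) * \<phi> (toep_unit d k) $$ (a, b))"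
    using cp unfolding T_def cp_map_def
    by (intro sum.cong refl) (subst linear_mat_map_toeplitz, auto)
  also have "\<dots> = (\<Sum>a<n. \<Sum>k\<in>{- int d<..<int d}. \<Sum>b<n. X (k, a, b) * \<phi> (toep_unit d k) $$ (a, b))"
    by (intro sum.cong refl sum.swap)
  also have "\<dots> = (\<Sum>k\<in>{- int d<..<int d}. \<Sum>a<n. \<Sum>b<n. X (k, a, b) * \<phi> (toep_unit d k) $$ (a, b))"
    by (rule sum.swap)
  finally show ?thesis
    by (simp add: sum.cartesian_product')
qed

lemma exists_psd_choi:
  assumes cp: "cp_map d (toeplitz d) n \<phi>" and "1 \<le> d" "1 \<le> n"
  obtains K where "psd_on ({..<d} \<times> {..<n}) K"
    "\<And>k p q. k \<in> {- int d<..<int d} \<Longrightarrow> p < n \<Longrightarrow> q < n \<Longrightarrow>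
       \<phi> (toep_unit d k) $$ (p, q) = diag_sum d (\<lambda>i j. K (i, p) (j, q)) k"
proof -
  let ?I = "{..<d} \<times> {..<n}" and ?S = "diag_indices d n"
  let ?L = "lin_fun ?I diag_coeff"
  define c where "c s = \<phi> (toep_unit d (fst s)) $$ snd s" for s
  obtain K0 where K0: "psd_on ?I K0"
    and le: "\<And>K. psd_on ?I K \<Longrightarrow> Re (\<Sum>s\<in>?S. cnj (c s - ?L K0 s) * ?L K s) \<le> 0"
    and norm: "(\<Sum>s\<in>?S. (cmod (c s - ?L K0 s))\<^sup>2) \<le> Re (\<Sum>s\<in>?S. cnj (c s - ?L K0 s) * c s)"
    using psd_image_residual[of ?I ?S diag_coeff c] trace_le_diag_norms[OF \<open>1 \<le> d\<close>] by auto
  \<comment> \<open>The sign is there because the residual pairs nonpositively with the cone; the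
    conjugate makes the pairing with diagonal sums bilinear.\<close>
  define X where "X s = - cnj (c s - ?L K0 s)" for s
  \<comment> \<open>This symmetry, inherited from \<open>c\<close> and \<open>K0\<close>, makes the
    quadratic form of \<open>X\<close> real, which minimality alone does not give.\<close>
  have X_herm: "X (- k, q, p) = cnj (X (k, p, q))"
    if "k \<in> {- int d<..<int d}" "p < n" "q < n" for k p q
  proof -
    have "?L K0 (- k, q, p) = (\<Sum>y\<in>?I. \<Sum>x\<in>?I. diag_coeff (- k, q, p) x y * K0 x y)"
      unfolding lin_fun_def by (rule sum.swap)
    also have "\<dots> = (\<Sum>y\<in>?I. \<Sum>x\<in>?I. cnj (diag_coeff (k, p, q) y x * K0 y x))"
    proof (intro sum.cong refl)
      fix x y assume "x \<in> ?I" "y \<in> ?I"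
      then have "K0 x y = cnj (K0 y x)"
        using psd_on_hermitian[OF K0, of y x] by simp
      then show "diag_coeff (- k, q, p) x y * K0 x y = cnj (diag_coeff (k, p, q) y x * K0 y x)"
        by (auto simp: diag_coeff_def)
    qed
    also have "\<dots> = cnj (?L K0 (k, p, q))"
      by (simp add: lin_fun_def)
    finally show ?thesis
      using toeplitz_map_hermitian[OF cp \<open>1 \<le> d\<close> that] by (simp add: X_def c_def)
  qed
  have "psd_on ?I (\<lambda>x y. X (int (fst y) - int (fst x), snd x, snd y))"
    unfolding psd_on_def
  proof
    fix v
    let ?Q = "\<Sum>x\<in>?I. \<Sum>y\<in>?I. X (int (fst y) - int (fst x), snd x, snd y) * v y * cnj (v x)"
    \<comment> \<open>Rank one kernels are the test objects: pairing \<open>X\<close> with the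
      diagonal sums of one returns the form of the block Toeplitz kernel of \<open>X\<close> at
      \<open>v\<close>.\<close>
    have "Re (\<Sum>s\<in>?S. cnj (c s - ?L K0 s) * ?L (\<lambda>x y. cnj (v x) * v y) s) \<le> 0"
      by (rule le[OF psd_on_rank_one])
    then have "0 \<le> Re (\<Sum>s\<in>?S. X s * ?L (\<lambda>x y. cnj (v x) * v y) s)"
      by (simp only: X_def mult_minus_left sum_negf uminus_complex.sel neg_0_le_iff_le)
    also have "(\<Sum>s\<in>?S. X s * ?L (\<lambda>x y. cnj (v x) * v y) s) = ?Q"
      unfolding sum_lin_fun_diag_coeff by (intro sum.cong refl) simp
    finally have "0 \<le> Re ?Q" .
    have "cnj ?Q = (\<Sum>x\<in>?I. \<Sum>y\<in>?I. cnj (X (int (fst y) - int (fst x), snd x, snd y)) * cnj (v y) * v x)"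
      by simp
    also have "\<dots> = (\<Sum>x\<in>?I. \<Sum>y\<in>?I. X (int (fst x) - int (fst y), snd y, snd x) * v x * cnj (v y))"
    proof (intro sum.cong refl)
      fix x y assume "x \<in> ?I" "y \<in> ?I"
      then show "cnj (X (int (fst y) - int (fst x), snd x, snd y)) * cnj (v y) * v x
          = X (int (fst x) - int (fst y), snd y, snd x) * v x * cnj (v y)"
        using X_herm[of "int (fst y) - int (fst x)" "snd x" "snd y"] by auto
    qed
    also have "\<dots> = ?Q"
      by (rule sum.swap)
    finally have "Im (cnj ?Q) = Im ?Q"
      by (rule arg_cong)
    then have "Im ?Q = 0"
      by (simp only: cnj.sel neg_equal_zero)
    with \<open>0 \<le> Re ?Q\<close> show "0 \<le> ?Q"
      by (simp only: less_eq_complex_def zero_complex.sel simp_thms)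
  qed
  from cp_map_toeplitz_pairing[OF cp \<open>1 \<le> n\<close> this]
  have "0 \<le> Re (\<Sum>s\<in>?S. X s * c s)"
    by (simp add: less_eq_complex_def c_def case_prod_beta)
  then have "(\<Sum>s\<in>?S. (cmod (c s - ?L K0 s))\<^sup>2) \<le> 0"
    using norm by (simp only: X_def mult_minus_left sum_negf uminus_complex.sel neg_0_le_iff_le)
  then have "(\<Sum>s\<in>?S. (cmod (c s - ?L K0 s))\<^sup>2) = 0"
    by (intro antisym sum_nonneg) auto
  then have eq: "c s = ?L K0 s" if "s \<in> ?S" for s
    using that by (subst (asm) sum_nonneg_eq_0_iff) auto
  show thesis
  proof (rule that[OF K0])
    fix k p q assume "k \<in> {- int d<..<int d}" "p < n" "q < n"
    then show "\<phi> (toep_unit d k) $$ (p, q) = diag_sum d (\<lambda>i j. K0 (i, p) (j, q)) k"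
      using eq[of "(k, p, q)"] by (simp add: c_def lin_fun_diag_coeff)
  qed
qed

section \<open>Factors and completely positive extensions\<close>

lemma block_mat_eq_iff:
  "block_mat d n X = block_mat d n Y \<longleftrightarrow>
    (\<forall>i<d. \<forall>j<d. \<forall>p<n. \<forall>q<n. X i j $$ (p, q) = Y i j $$ (p, q))"
proof (intro iffI allI impI)
  fix i j p q assume eq: "block_mat d n X = block_mat d n Y" and lt: "i < d" "j < d" "p < n" "q < n"
  have "block_mat d n Z $$ (i * n + p, j * n + q) = Z i j $$ (p, q)" for Z
    using lt by (simp add: block_mat_def mult_add_less_mult)
  then show "X i j $$ (p, q) = Y i j $$ (p, q)"
    using eq by metis
next
  assume eq: "\<forall>i<d. \<forall>j<d. \<forall>p<n. \<forall>q<n. X i j $$ (p, q) = Y i j $$ (p, q)"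
  show "block_mat d n X = block_mat d n Y"
  proof (rule eq_matI)
    fix r c assume "r < dim_row (block_mat d n Y)" "c < dim_col (block_mat d n Y)"
    then have rc: "r < d * n" "c < d * n"
      by (auto simp: block_mat_def)
    then have "0 < n" by (cases n) auto
    with rc eq show "block_mat d n X $$ (r, c) = block_mat d n Y $$ (r, c)"
      by (simp add: block_mat_def less_mult_imp_div_less)
  qed (simp_all add: block_mat_def)
qed

text \<open>The linear map whose Choi matrix is the Gram matrix of \<open>F\<close>. The
  \<open>restrict\<close> meets the extensionality clause of \<open>cp_extension\<close>.\<close>

definition gram_map :: "nat \<Rightarrow> nat \<Rightarrow> (nat \<Rightarrow> complex mat) \<Rightarrow> complex mat \<Rightarrow> complex mat" where
  "gram_map d n F = restrict
     (\<lambda>A. mat n n (\<lambda>(p, q). \<Sum>i<d. \<Sum>j<d. A $$ (i, j) * (mat_adjoint (F i) * F j) $$ (p, q))) (carrier_mat d d)"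

lemma gram_map_index:
  assumes "A \<in> carrier_mat d d" "p < n" "q < n"
  shows "gram_map d n F A $$ (p, q) = (\<Sum>i<d. \<Sum>j<d. A $$ (i, j) * (mat_adjoint (F i) * F j) $$ (p, q))"
  using assms by (simp add: gram_map_def)

lemma gram_map_carrier: "A \<in> carrier_mat d d \<Longrightarrow> gram_map d n F A \<in> carrier_mat n n"
  by (simp add: gram_map_def)

lemma gram_map_linear: "linear_mat_map (carrier_mat d d) n (gram_map d n F)"
  unfolding linear_mat_map_def
proof (intro conjI ballI allI)
  fix A B :: "complex mat" assume AB: "A \<in> carrier_mat d d" "B \<in> carrier_mat d d"
  show "gram_map d n F (A + B) = gram_map d n F A + gram_map d n F B"
  proof (rule eq_matI)
    fix p q assume "p < dim_row (gram_map d n F A + gram_map d n F B)"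
      "q < dim_col (gram_map d n F A + gram_map d n F B)"
    then have pq: "p < n" "q < n"
      using gram_map_carrier[OF AB(2), of n F] by auto
    have "(A + B) $$ (i, j) = A $$ (i, j) + B $$ (i, j)" if "i < d" "j < d" for i j
      using that AB by simp
    then have "gram_map d n F (A + B) $$ (p, q) = gram_map d n F A $$ (p, q) + gram_map d n F B $$ (p, q)"
      using AB pq by (simp add: gram_map_index distrib_right sum.distrib)
    then show "gram_map d n F (A + B) $$ (p, q) = (gram_map d n F A + gram_map d n F B) $$ (p, q)"
      using pq gram_map_carrier[OF AB(2), of n F] by simp
  qed (use gram_map_carrier[of _ d n F] AB in \<open>auto simp: gram_map_def\<close>)
next
  fix A :: "complex mat" and c assume A: "A \<in> carrier_mat d d"
  show "gram_map d n F (c \<cdot>\<^sub>m A) = c \<cdot>\<^sub>m gram_map d n F A"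
  proof (rule eq_matI)
    fix p q assume "p < dim_row (c \<cdot>\<^sub>m gram_map d n F A)" "q < dim_col (c \<cdot>\<^sub>m gram_map d n F A)"
    then have pq: "p < n" "q < n"
      using gram_map_carrier[OF A, of n F] by auto
    have "(c \<cdot>\<^sub>m A) $$ (i, j) = c * A $$ (i, j)" if "i < d" "j < d" for i j
      using that A by simp
    then have "gram_map d n F (c \<cdot>\<^sub>m A) $$ (p, q) = c * gram_map d n F A $$ (p, q)"
      using A pq by (simp add: gram_map_index sum_distrib_left mult.assoc)
    then show "gram_map d n F (c \<cdot>\<^sub>m A) $$ (p, q) = (c \<cdot>\<^sub>m gram_map d n F A) $$ (p, q)"
      using pq gram_map_carrier[OF A, of n F] by simp
  qed (use A in \<open>auto simp: gram_map_def\<close>)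
qed (rule gram_map_carrier)

lemma gram_map_mat_unit:
  assumes "i < d" "j < d" "p < n" "q < n"
  shows "gram_map d n F (mat_unit d i j) $$ (p, q) = (mat_adjoint (F i) * F j) $$ (p, q)"
proof -
  have "gram_map d n F (mat_unit d i j) $$ (p, q)
      = (\<Sum>a<d. \<Sum>b<d. mat_unit d i j $$ (a, b) * (mat_adjoint (F a) * F b) $$ (p, q))"
    using assms by (simp add: gram_map_index)
  also have "\<dots> = (\<Sum>a<d. \<Sum>b<d. if b = j then (if a = i then (mat_adjoint (F a) * F b) $$ (p, q) else 0) else 0)"
    by (intro sum.cong refl) (auto simp: mat_unit_def)
  also have "\<dots> = (mat_adjoint (F i) * F j) $$ (p, q)"
    using assms by (simp add: sum.delta)
  finally show ?thesis .
qed

text \<open>The ampliation of \<open>gram_map\<close> is the sum over the rows \<open>r\<close> of all \<open>F j\<close> of the congruences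
  with the row vectors \<open>F j $$ (r, _)\<close>: these are its Kraus operators.\<close>

lemma gram_map_cp:
  assumes F: "\<And>j. j < d \<Longrightarrow> F j \<in> carrier_mat m n"
  shows "cp_map d (carrier_mat d d) n (gram_map d n F)"
  unfolding cp_map_def
proof (intro conjI gram_map_linear allI impI)
  fix k X assume "1 \<le> k"
    and "(\<forall>i<k. \<forall>j<k. X i j \<in> carrier_mat d d) \<and> psd_mat (k * d) (block_mat k d X)"
  then have car: "\<And>i j. i < k \<Longrightarrow> j < k \<Longrightarrow> X i j \<in> carrier_mat d d"
    and psd: "psd_on ({..<k} \<times> {..<d}) (\<lambda>x y. X (fst x) (fst y) $$ (snd x, snd y))"
    by (auto simp: psd_block_mat_iff)
  let ?J = "{..<k} \<times> {..<d}" and ?I = "{..<k} \<times> {..<n}"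
  \<comment> \<open>\<open>W r\<close> is the identity on the \<open>k\<close> blocks tensored with
    the \<open>d\<close> by \<open>n\<close> matrix whose row \<open>j\<close> is row
    \<open>r\<close> of \<open>F j\<close>.\<close>
  define W where "W r u x = (if fst u = fst x then F (snd u) $$ (r, snd x) else 0)" for r and u x :: "nat \<times> nat"
  define Y where "Y r x y = (\<Sum>u\<in>?J. \<Sum>w\<in>?J. cnj (W r u x) * X (fst u) (fst w) $$ (snd u, snd w) * W r w y)" for r x y
  have "psd_on ?I (\<lambda>x y. \<Sum>r<m. Y r x y)"
    unfolding Y_def by (intro psd_on_sum psd_on_congruence psd)
  moreover have "(\<Sum>r<m. Y r x y) = gram_map d n F (X (fst x) (fst y)) $$ (snd x, snd y)"
    if "x \<in> ?I" "y \<in> ?I" for x y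
  proof -
    from that obtain a p b q where xy: "x = (a, p)" "y = (b, q)" and lt: "a < k" "b < k" "p < n" "q < n"
      by (cases x; cases y) auto
    have W_sum: "(\<Sum>u\<in>?J. f u * W r u z) = (\<Sum>i<d. f (fst z, i) * F i $$ (r, snd z))"
      if "fst z < k" for f :: "nat \<times> nat \<Rightarrow> complex" and r z
    proof -
      have "(\<Sum>u\<in>?J. f u * W r u z)
          = (\<Sum>a<k. if a = fst z then (\<Sum>i<d. f (a, i) * F i $$ (r, snd z)) else 0)"
        unfolding sum.cartesian_product' by (intro sum.cong refl) (auto simp: W_def)
      then show ?thesis
        using that by (simp add: sum.delta)
    qed
    have cnj_W_sum: "(\<Sum>u\<in>?J. cnj (W r u z) * f u) = (\<Sum>i<d. cnj (F i $$ (r, snd z)) * f (fst z, i))"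
      if "fst z < k" for f :: "nat \<times> nat \<Rightarrow> complex" and r z
      using arg_cong[OF W_sum[OF that, of "\<lambda>u. cnj (f u)" r], of cnj] by (simp add: mult.commute)
    have "Y r x y = (\<Sum>i<d. \<Sum>j<d. X a b $$ (i, j) * (cnj (F i $$ (r, p)) * F j $$ (r, q)))" for r
    proof -
      have "Y r x y = (\<Sum>u\<in>?J. cnj (W r u x) * (\<Sum>w\<in>?J. X (fst u) (fst w) $$ (snd u, snd w) * W r w y))"
        unfolding Y_def by (simp only: sum_distrib_left mult.assoc)
      also have "\<dots> = (\<Sum>i<d. cnj (F i $$ (r, p)) * (\<Sum>j<d. X a b $$ (i, j) * F j $$ (r, q)))"
        using lt by (simp add: W_sum cnj_W_sum xy)
      finally show ?thesis
        by (simp add: sum_distrib_left mult_ac)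
    qed
    then have "(\<Sum>r<m. Y r x y) = (\<Sum>r<m. \<Sum>i<d. \<Sum>j<d. X a b $$ (i, j) * (cnj (F i $$ (r, p)) * F j $$ (r, q)))"
      by simp
    also have "\<dots> = (\<Sum>i<d. \<Sum>r<m. \<Sum>j<d. X a b $$ (i, j) * (cnj (F i $$ (r, p)) * F j $$ (r, q)))"
      by (rule sum.swap)
    also have "\<dots> = (\<Sum>i<d. \<Sum>j<d. \<Sum>r<m. X a b $$ (i, j) * (cnj (F i $$ (r, p)) * F j $$ (r, q)))"
      by (intro sum.cong refl sum.swap)
    also have "\<dots> = (\<Sum>i<d. \<Sum>j<d. X a b $$ (i, j) * (mat_adjoint (F i) * F j) $$ (p, q))"
      using lt by (intro sum.cong refl) (simp add: adjoint_mult_index[OF F F] sum_distrib_left)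
    also have "\<dots> = gram_map d n F (X a b) $$ (p, q)"
      using lt car by (simp add: gram_map_index)
    finally show ?thesis
      by (simp add: xy)
  qed
  ultimately have "psd_on ?I (\<lambda>x y. gram_map d n F (X (fst x) (fst y)) $$ (snd x, snd y))"
    by (subst psd_on_cong[where K' = "\<lambda>x y. \<Sum>r<m. Y r x y"]) auto
  then show "psd_mat (k * n) (block_mat k n (\<lambda>i j. gram_map d n F (X i j)))"
    by (simp only: psd_block_mat_iff)
qed

text \<open>A Toeplitz matrix is constant along diagonals, so \<open>gram_map\<close> at it sees
  only the diagonal sums of the Gram matrix, and for a factor these are the coefficients of
  \<open>\<phi>\<close>.\<close>

lemma fejer_riesz_factor_cp_extension:
  assumes lin: "linear_mat_map (toeplitz d) n \<phi>" and "1 \<le> d" and F: "fejer_riesz_factor d n \<phi> m F"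
  shows "cp_extension d n \<phi> (gram_map d n F)"
  unfolding cp_extension_def
proof (intro conjI ballI)
  have car: "\<And>j. j < d \<Longrightarrow> F j \<in> carrier_mat m n"
    and coeff: "\<And>k p q. k \<in> {- int d<..<int d} \<Longrightarrow> p < n \<Longrightarrow> q < n \<Longrightarrow>
      \<phi> (toep_unit d k) $$ (p, q) = diag_sum d (\<lambda>i j. (mat_adjoint (F i) * F j) $$ (p, q)) k"
    using F unfolding fejer_riesz_factor_iff[OF assms(1,2)] by auto
  show "gram_map d n F \<in> extensional (carrier_mat d d)"
    by (simp add: gram_map_def)
  show "cp_map d (carrier_mat d d) n (gram_map d n F)"
    by (rule gram_map_cp[OF car])
  fix A assume A: "A \<in> toeplitz d"
  then have A_car: "A \<in> carrier_mat d d"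
    using toeplitz_carrier by blast
  have \<phi>A: "\<phi> A \<in> carrier_mat n n"
    using lin A by (simp add: linear_mat_map_def)
  from A obtain a where a: "A = mat d d (\<lambda>(i, j). a (int i - int j))"
    unfolding toeplitz_def by blast
  show "gram_map d n F A = \<phi> A"
  proof (rule eq_matI)
    fix p q assume "p < dim_row (\<phi> A)" "q < dim_col (\<phi> A)"
    then have pq: "p < n" "q < n"
      using \<phi>A by auto
    have "gram_map d n F A $$ (p, q)
        = (\<Sum>i<d. \<Sum>j<d. (\<lambda>m. a (- m)) (int j - int i) * (mat_adjoint (F i) * F j) $$ (p, q))"
      unfolding gram_map_index[OF A_car pq] by (intro sum.cong refl) (simp add: a)
    also have "\<dots> = (\<Sum>k\<in>{- int d<..<int d}. a (- k) * diag_sum d (\<lambda>i j. (mat_adjoint (F i) * F j) $$ (p, q)) k)"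
      unfolding diag_sum_def by (rule sum_by_diagonal)
    also have "\<dots> = \<phi> A $$ (p, q)"
      unfolding a linear_mat_map_toeplitz[OF lin pq] using pq by (intro sum.cong refl) (simp add: coeff)
    finally show "gram_map d n F A $$ (p, q) = \<phi> A $$ (p, q)" .
  qed (use gram_map_carrier[OF A_car, of n F] \<phi>A in auto)
qed

text \<open>Choi's construction: the ampliation of \<open>\<psi>\<close> sends the positive block
  matrix of all matrix units to a positive one, which is then factored. The second conclusion lets
  equality of Gram matrices be read back as equality of extensions.\<close>

lemma cp_extension_fejer_riesz_factor:
  assumes lin: "linear_mat_map (toeplitz d) n \<phi>" and "1 \<le> d" and \<psi>: "cp_extension d n \<phi> \<psi>"
  obtains F where "fejer_riesz_factor d n \<phi> (d * n) F"
    "\<And>i j p q. i < d \<Longrightarrow> j < d \<Longrightarrow> p < n \<Longrightarrow> q < n \<Longrightarrow>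
       \<psi> (mat_unit d i j) $$ (p, q) = (mat_adjoint (F i) * F j) $$ (p, q)"
proof -
  have cp: "cp_map d (carrier_mat d d) n \<psi>" and ext: "\<And>A. A \<in> toeplitz d \<Longrightarrow> \<psi> A = \<phi> A"
    using \<psi> by (auto simp: cp_extension_def)
  then have lin_\<psi>: "linear_mat_map (carrier_mat d d) n \<psi>"
    by (simp add: cp_map_def)
  \<comment> \<open>The block matrix of all matrix units has rank one; it comes from the vector that
    is the sum of all e_i \<otimes> e_i.\<close>
  have "psd_on ({..<d} \<times> {..<d}) (\<lambda>x y. mat_unit d (fst x) (fst y) $$ (snd x, snd y)) \<longleftrightarrow>
      psd_on ({..<d} \<times> {..<d}) (\<lambda>x y. cnj (if fst x = snd x then 1 else 0) * (if fst y = snd y then 1 else 0))"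
    by (rule psd_on_cong) (auto simp: mat_unit_def)
  from iffD2[OF this psd_on_rank_one] have "psd_mat (d * d) (block_mat d d (mat_unit d))"
    by (simp only: psd_block_mat_iff)
  then have "psd_mat (d * n) (block_mat d n (\<lambda>i j. \<psi> (mat_unit d i j)))"
    by (rule cp_map_ampliation[OF cp \<open>1 \<le> d\<close> mat_unit_carrier])
  then have choi: "psd_on ({..<d} \<times> {..<n}) (\<lambda>x y. \<psi> (mat_unit d (fst x) (fst y)) $$ (snd x, snd y))"
    by (simp only: psd_block_mat_iff)
  obtain F where car: "\<And>j. F j \<in> carrier_mat (d * n) n"
    and F: "\<And>i j p q. i < d \<Longrightarrow> j < d \<Longrightarrow> p < n \<Longrightarrow> q < n \<Longrightarrow>
       (mat_adjoint (F i) * F j) $$ (p, q) = \<psi> (mat_unit d i j) $$ (p, q)"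
    using psd_factor_blocks[OF choi] by auto
  have "\<phi> (toep_unit d k) $$ (p, q) = diag_sum d (\<lambda>i j. (mat_adjoint (F i) * F j) $$ (p, q)) k"
    if "p < n" "q < n" for k p q
  proof -
    have "\<phi> (toep_unit d k) $$ (p, q) = \<psi> (toep_unit d k) $$ (p, q)"
      by (simp add: ext)
    also have "\<dots> = (\<Sum>i<d. \<Sum>j<d. toep_unit d k $$ (i, j) * \<psi> (mat_unit d i j) $$ (p, q))"
      by (rule linear_mat_map_full[OF lin_\<psi> that toep_unit_carrier])
    also have "\<dots> = diag_sum d (\<lambda>i j. (mat_adjoint (F i) * F j) $$ (p, q)) k"
      unfolding diag_sum_def using that by (intro sum.cong refl) (auto simp: toep_unit_def F)
    finally show ?thesis .
  qed
  then have "fejer_riesz_factor d n \<phi> (d * n) F"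
    unfolding fejer_riesz_factor_iff[OF assms(1,2)] using car by auto
  with F show thesis
    by (intro that) auto
qed

lemma cp_extension_eqI:
  assumes "cp_extension d n \<phi> \<psi>" "cp_extension d n \<phi> \<psi>'"
    and eq: "\<And>i j p q. i < d \<Longrightarrow> j < d \<Longrightarrow> p < n \<Longrightarrow> q < n \<Longrightarrow>
      \<psi> (mat_unit d i j) $$ (p, q) = \<psi>' (mat_unit d i j) $$ (p, q)"
  shows "\<psi> = \<psi>'"
proof (rule extensionalityI)
  show "\<psi> \<in> extensional (carrier_mat d d)" "\<psi>' \<in> extensional (carrier_mat d d)"
    using assms by (auto simp: cp_extension_def)
  fix A :: "complex mat" assume A: "A \<in> carrier_mat d d"
  have lin: "linear_mat_map (carrier_mat d d) n \<psi>" "linear_mat_map (carrier_mat d d) n \<psi>'"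
    using assms by (auto simp: cp_extension_def cp_map_def)
  then have car: "\<psi> A \<in> carrier_mat n n" "\<psi>' A \<in> carrier_mat n n"
    using A by (auto simp: linear_mat_map_def)
  show "\<psi> A = \<psi>' A"
  proof (rule eq_matI)
    fix p q assume "p < dim_row (\<psi>' A)" "q < dim_col (\<psi>' A)"
    then have pq: "p < n" "q < n"
      using car by auto
    show "\<psi> A $$ (p, q) = \<psi>' A $$ (p, q)"
      unfolding linear_mat_map_full[OF lin(1) pq A] linear_mat_map_full[OF lin(2) pq A]
      using pq by (intro sum.cong refl) (simp add: eq)
  qed (use car in auto)
qed

theorem proposition5p3:
  fixes d n :: nat and \<phi> :: "complex mat \<Rightarrow> complex mat"
  assumes "d \<ge> 1" and "n \<ge> 1"
    and "cp_map d (toeplitz d) n \<phi>"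
  shows "(\<exists>!\<psi>. cp_extension d n \<phi> \<psi>) \<longleftrightarrow>
    (\<forall>m m' F H. m \<ge> 1 \<and> m' \<ge> 1 \<and>
       fejer_riesz_factor d n \<phi> m F \<and> fejer_riesz_factor d n \<phi> m' H
       \<longrightarrow> gram_mat d n F = gram_mat d n H)"
proof
  have lin: "linear_mat_map (toeplitz d) n \<phi>"
    using assms(3) by (simp add: cp_map_def)
  note ext = fejer_riesz_factor_cp_extension[OF lin assms(1)]
  {
    assume unique: "\<exists>!\<psi>. cp_extension d n \<phi> \<psi>"
    show "\<forall>m m' F H. m \<ge> 1 \<and> m' \<ge> 1 \<and>
       fejer_riesz_factor d n \<phi> m F \<and> fejer_riesz_factor d n \<phi> m' H
       \<longrightarrow> gram_mat d n F = gram_mat d n H"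
    proof (intro allI impI, elim conjE)
      fix m m' F H
      assume "fejer_riesz_factor d n \<phi> m F" "fejer_riesz_factor d n \<phi> m' H"
      \<comment> \<open>Both maps extend \<open>\<phi>\<close>, whatever the two numbers of rows;
        their values at matrix units are the blocks of the Gram matrices.\<close>
      then have "gram_map d n F = gram_map d n H"
        using unique ext by blast
      then show "gram_mat d n F = gram_mat d n H"
        unfolding gram_mat_def block_mat_eq_iff by (metis gram_map_mat_unit)
    qed
  next
    assume gram: "\<forall>m m' F H. m \<ge> 1 \<and> m' \<ge> 1 \<and>
       fejer_riesz_factor d n \<phi> m F \<and> fejer_riesz_factor d n \<phi> m' H
       \<longrightarrow> gram_mat d n F = gram_mat d n H"
    \<comment> \<open>The criterion speaks of factors with at least one row, and factors obtained
      from Choi matrices have \<open>d * n\<close> rows.\<close>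
    have "1 \<le> d * n"
      using assms by simp
    obtain K where K: "psd_on ({..<d} \<times> {..<n}) K"
      "\<And>k p q. k \<in> {- int d<..<int d} \<Longrightarrow> p < n \<Longrightarrow> q < n \<Longrightarrow>
         \<phi> (toep_unit d k) $$ (p, q) = diag_sum d (\<lambda>i j. K (i, p) (j, q)) k"
      using exists_psd_choi[OF assms(3,1,2)] by blast
    obtain F where F: "\<And>j. F j \<in> carrier_mat (d * n) n"
      "\<And>i j p q. i < d \<Longrightarrow> j < d \<Longrightarrow> p < n \<Longrightarrow> q < n \<Longrightarrow>
         (mat_adjoint (F i) * F j) $$ (p, q) = K (i, p) (j, q)"
      using psd_factor_blocks[OF K(1)] by blast
    have "fejer_riesz_factor d n \<phi> (d * n) F"
      unfolding fejer_riesz_factor_iff[OF lin assms(1)]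
    proof (intro conjI allI ballI impI F(1))
      fix k p q assume k: "k \<in> {- int d<..<int d}" and pq: "p < n" "q < n"
      have "diag_sum d (\<lambda>i j. (mat_adjoint (F i) * F j) $$ (p, q)) k = diag_sum d (\<lambda>i j. K (i, p) (j, q)) k"
        by (rule diag_sum_cong) (simp add: F(2) pq)
      then show "\<phi> (toep_unit d k) $$ (p, q) = diag_sum d (\<lambda>i j. (mat_adjoint (F i) * F j) $$ (p, q)) k"
        by (simp add: K(2)[OF k pq])
    qed
    then have "cp_extension d n \<phi> (gram_map d n F)"
      by (rule ext)
    moreover have "\<psi> = \<psi>'" if ext: "cp_extension d n \<phi> \<psi>" "cp_extension d n \<phi> \<psi>'" for \<psi> \<psi>'
    proof -
      obtain F where F: "fejer_riesz_factor d n \<phi> (d * n) F"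
        "\<And>i j p q. i < d \<Longrightarrow> j < d \<Longrightarrow> p < n \<Longrightarrow> q < n \<Longrightarrow>
           \<psi> (mat_unit d i j) $$ (p, q) = (mat_adjoint (F i) * F j) $$ (p, q)"
        using cp_extension_fejer_riesz_factor[OF lin assms(1) ext(1)] by blast
      obtain H where H: "fejer_riesz_factor d n \<phi> (d * n) H"
        "\<And>i j p q. i < d \<Longrightarrow> j < d \<Longrightarrow> p < n \<Longrightarrow> q < n \<Longrightarrow>
           \<psi>' (mat_unit d i j) $$ (p, q) = (mat_adjoint (H i) * H j) $$ (p, q)"
        using cp_extension_fejer_riesz_factor[OF lin assms(1) ext(2)] by blast
      have "gram_mat d n F = gram_mat d n H"
        using gram F(1) H(1) \<open>1 \<le> d * n\<close> by blast
      then show ?thesis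
        using ext F(2) H(2) unfolding gram_mat_def block_mat_eq_iff
        by (intro cp_extension_eqI[of d n \<phi>]) auto
    qed
    ultimately show "\<exists>!\<psi>. cp_extension d n \<phi> \<psi>"
      by blast
  }
qed

end
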